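(* Let $E$ and $F$ be Banach lattices. (a) If the adjoint $T^* \colon F^* \longrightarrow E^*$ of every positive Dunford-Pettis operator $T\colon E\longrightarrow F$ is almost Dunford-Pettis, then $E^{*}$ has order continuous norm or $F^{*}$ has the positive Schur property. (b) If every positive Dunford-Pettis operator $T\colon E\longrightarrow F$ is positively limited, then $E^{*}$ has order continuous norm or $F$ has the dual positive Schur property.
   Context: Operators are linear. An operator between Banach spaces is Dunford-Pettis if it sends weakly null sequences to norm null sequences. An operator from a Banach lattice to a Banach space is almost Dunford-Pettis if it sends disjoint weakly null sequences to norm null sequences (equivalently, positive disjoint weakly null sequences to norm null sequences). An operator $T$ from a Banach space $X$ to a Banach lattice $F$ is positively limited if $T^*$ takes positive weak$^*$-null sequences in $F^*$ to norm null sequences in $X^*$. A Banach lattice has the positive Schur property if every weakly null sequence of positive elements in it is norm null. A Banach lattice $F$ has the dual positive Schur property if every positive weak$^*$-null sequence in $F^*$ is norm null. *)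

theory Defs
  imports "HOL-Analysis.Analysis" "HOL-Library.Lattice_Algebras"
begin

section \<open>Banach lattices\<close>

class banach_lattice = banach + ordered_real_vector + lattice_ab_group_add_abs +
  assumes lattice_norm: "\<bar>x\<bar> \<le> \<bar>y\<bar> \<Longrightarrow> norm x \<le> norm y"

instance real :: banach_lattice
  by standard simp

lemma norm_pprt_le: "norm (pprt x) \<le> norm (x :: 'a::banach_lattice)"
proof (rule lattice_norm)
  show "\<bar>pprt x\<bar> \<le> \<bar>x\<bar>"
    by (simp add: abs_prts[of x])
qed

lemma norm_nprt_le: "norm (nprt x) \<le> norm (x :: 'a::banach_lattice)"
proof (rule lattice_norm)
  show "\<bar>nprt x\<bar> \<le> \<bar>x\<bar>"
    by (simp add: abs_prts[of x])
qed

lemma norm_abs_lattice: "norm \<bar>x\<bar> = norm (x :: 'a::banach_lattice)"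
  by (rule antisym; rule lattice_norm; simp)


section \<open>The Banach lattice of bounded operators\<close>

text \<open>
  Operators are ordered by the cone of positive operators, so that \<^prop>\<open>0 \<le> T\<close> says that
  \<open>T\<close> is positive.
\<close>

instantiation blinfun :: (banach_lattice, banach_lattice) ordered_real_vector
begin

definition less_eq_blinfun :: "('a \<Rightarrow>\<^sub>L 'b) \<Rightarrow> ('a \<Rightarrow>\<^sub>L 'b) \<Rightarrow> bool"
  where "S \<le> T \<longleftrightarrow> (\<forall>x\<ge>0. blinfun_apply S x \<le> blinfun_apply T x)"

definition less_blinfun :: "('a \<Rightarrow>\<^sub>L 'b) \<Rightarrow> ('a \<Rightarrow>\<^sub>L 'b) \<Rightarrow> bool"
  where "S < T \<longleftrightarrow> S \<le> T \<and> \<not> T \<le> (S :: 'a \<Rightarrow>\<^sub>L 'b)"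

instance
proof
  fix R S T :: "'a \<Rightarrow>\<^sub>L 'b" and a b :: real
  show "S < T \<longleftrightarrow> S \<le> T \<and> \<not> T \<le> S" by (simp add: less_blinfun_def)
  show "S \<le> S" by (simp add: less_eq_blinfun_def)
  show "R \<le> T" if "R \<le> S" "S \<le> T"
    using that unfolding less_eq_blinfun_def by (meson order_trans)
  show "S = T" if "S \<le> T" "T \<le> S"
  proof (rule blinfun_eqI)
    fix x
    have *: "S z = T z" if "z \<ge> 0" for z
      using \<open>S \<le> T\<close> \<open>T \<le> S\<close> that by (auto simp: less_eq_blinfun_def intro: order.antisym)
    have "S (pprt x - (- nprt x)) = T (pprt x - (- nprt x))"
      using *[of "pprt x"] *[of "- nprt x"] unfolding blinfun.diff_right by simp
    then show "S x = T x" using prts[of x] by simp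
  qed
  show "R + S \<le> R + T" if "S \<le> T"
    using that by (auto simp: less_eq_blinfun_def blinfun.add_left)
  show "a *\<^sub>R S \<le> a *\<^sub>R T" if "S \<le> T" "0 \<le> a"
    using that by (auto simp: less_eq_blinfun_def blinfun.scaleR_left intro: scaleR_left_mono)
  show "a *\<^sub>R S \<le> b *\<^sub>R S" if "a \<le> b" "0 \<le> S"
    using that by (auto simp: less_eq_blinfun_def blinfun.scaleR_left intro: scaleR_right_mono)
qed

end

text \<open>
  Dedekind complete AM-spaces with unit. Bounded operators into such a space form a Banach
  lattice under the operator norm; for the codomain \<^typ>\<open>real\<close> this is the dual Banach lattice.
\<close>

class dedekind_complete_AM_unit = banach_lattice + conditionally_complete_lattice +
  assumes ex_order_unit: "\<exists>u. \<forall>r\<ge>0. \<forall>x. norm x \<le> r \<longleftrightarrow> \<bar>x\<bar> \<le> r *\<^sub>R u"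

instance real :: dedekind_complete_AM_unit
  by standard (rule exI[of _ 1], simp)

context
  fixes h :: "'a::banach_lattice \<Rightarrow>\<^sub>L 'b::dedekind_complete_AM_unit"
begin

definition pos_cone :: "'a \<Rightarrow> 'b"
  where "pos_cone x = Sup (blinfun_apply h ` {0..x})"

lemma pos_cone_bdd: "bdd_above (blinfun_apply h ` {0..x})"
proof -
  obtain u :: 'b where u: "\<forall>r\<ge>0. \<forall>z. norm z \<le> r \<longleftrightarrow> \<bar>z\<bar> \<le> r *\<^sub>R u"
    using ex_order_unit by blast
  have "h y \<le> (norm h * norm x) *\<^sub>R u" if "y \<in> {0..x}" for y
  proof -
    have "norm y \<le> norm x" using that by (intro lattice_norm) auto
    then have "norm (h y) \<le> norm h * norm x"
      by (meson norm_blinfun mult_left_mono norm_ge_zero order_trans)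
    then have "\<bar>h y\<bar> \<le> (norm h * norm x) *\<^sub>R u" using u by simp
    then show ?thesis using abs_ge_self order_trans by blast
  qed
  then show ?thesis by (intro bdd_aboveI[of _ "(norm h * norm x) *\<^sub>R u"]) auto
qed

lemma pos_cone_upper: "0 \<le> y \<Longrightarrow> y \<le> x \<Longrightarrow> h y \<le> pos_cone x"
  unfolding pos_cone_def by (intro cSup_upper pos_cone_bdd) auto

lemma pos_cone_least: "0 \<le> x \<Longrightarrow> (\<And>y. 0 \<le> y \<Longrightarrow> y \<le> x \<Longrightarrow> h y \<le> z) \<Longrightarrow> pos_cone x \<le> z"
  unfolding pos_cone_def by (intro cSup_least) auto

lemma pos_cone_nonneg: "0 \<le> x \<Longrightarrow> 0 \<le> pos_cone x"
  using pos_cone_upper[of 0 x] by (simp add: blinfun.zero_right)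

lemma pos_cone_add:
  assumes "0 \<le> x" "0 \<le> y"
  shows "pos_cone (x + y) = pos_cone x + pos_cone y"
proof (rule order.antisym)
  show "pos_cone (x + y) \<le> pos_cone x + pos_cone y"
  proof (rule pos_cone_least)
    fix c assume c: "0 \<le> c" "c \<le> x + y"
    have "c - inf c x \<le> y"
    proof -
      have "c \<le> inf c x + y"
        using c assms by (simp add: add_inf_distrib_right)
      then show ?thesis by (simp only: diff_le_eq add.commute)
    qed
    moreover have "0 \<le> c - inf c x" by (simp only: diff_ge_0_iff_ge inf_le1)
    moreover have "0 \<le> inf c x" using c assms by simp
    ultimately have "h (inf c x) + h (c - inf c x) \<le> pos_cone x + pos_cone y"
      by (intro add_mono pos_cone_upper) auto
    then show "h c \<le> pos_cone x + pos_cone y"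
      by (simp only: add_diff_eq add_diff_cancel_left' flip: blinfun.add_right)
  qed (use assms in auto)
  have "pos_cone x \<le> pos_cone (x + y) - pos_cone y"
  proof (rule pos_cone_least)
    fix a assume a: "0 \<le> a" "a \<le> x"
    have "pos_cone y \<le> pos_cone (x + y) - h a"
    proof (rule pos_cone_least)
      fix b assume "0 \<le> b" "b \<le> y"
      then have "h (a + b) \<le> pos_cone (x + y)"
        using a by (intro pos_cone_upper add_mono add_nonneg_nonneg)
      then show "h b \<le> pos_cone (x + y) - h a"
        by (simp add: blinfun.add_right le_diff_eq add.commute)
    qed (use assms in auto)
    then show "h a \<le> pos_cone (x + y) - pos_cone y" by (simp add: le_diff_eq add.commute)
  qed (use assms in auto)
  then show "pos_cone x + pos_cone y \<le> pos_cone (x + y)" by (simp add: le_diff_eq)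
qed

lemma pos_cone_scaleR_le:
  assumes "0 \<le> x" "0 < r"
  shows "r *\<^sub>R pos_cone x \<le> pos_cone (r *\<^sub>R x)"
proof -
  have "pos_cone x \<le> inverse r *\<^sub>R pos_cone (r *\<^sub>R x)"
  proof (rule pos_cone_least)
    fix y assume "0 \<le> y" "y \<le> x"
    then have "h (r *\<^sub>R y) \<le> pos_cone (r *\<^sub>R x)"
      using assms by (intro pos_cone_upper scaleR_left_mono scaleR_nonneg_nonneg) auto
    then have "inverse r *\<^sub>R h (r *\<^sub>R y) \<le> inverse r *\<^sub>R pos_cone (r *\<^sub>R x)"
      using assms by (intro scaleR_left_mono) auto
    then show "h y \<le> inverse r *\<^sub>R pos_cone (r *\<^sub>R x)"
      using assms by (simp add: blinfun.scaleR_right)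
  qed (use assms in auto)
  then have "r *\<^sub>R pos_cone x \<le> r *\<^sub>R (inverse r *\<^sub>R pos_cone (r *\<^sub>R x))"
    using assms by (intro scaleR_left_mono) auto
  then show ?thesis using assms by simp
qed

lemma pos_cone_0: "pos_cone 0 = 0"
  using pos_cone_add[of 0 0] by simp

lemma pos_cone_scaleR:
  assumes "0 \<le> x" "0 \<le> r"
  shows "pos_cone (r *\<^sub>R x) = r *\<^sub>R pos_cone x"
proof (cases "r = 0")
  case False
  then have r: "r > 0" using assms by simp
  have "inverse r *\<^sub>R pos_cone (r *\<^sub>R x) \<le> pos_cone (inverse r *\<^sub>R r *\<^sub>R x)"
    using r assms by (intro pos_cone_scaleR_le scaleR_nonneg_nonneg) auto
  then have "r *\<^sub>R (inverse r *\<^sub>R pos_cone (r *\<^sub>R x)) \<le> r *\<^sub>R pos_cone x"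
    using r by (intro scaleR_left_mono) auto
  then have "pos_cone (r *\<^sub>R x) \<le> r *\<^sub>R pos_cone x" using r by simp
  then show ?thesis using pos_cone_scaleR_le[OF \<open>0 \<le> x\<close> r] by (rule order.antisym)
qed (simp add: pos_cone_0)

lemma pos_cone_norm:
  assumes "0 \<le> x"
  shows "norm (pos_cone x) \<le> norm h * norm x"
proof -
  obtain u :: 'b where u: "\<forall>r\<ge>0. \<forall>z. norm z \<le> r \<longleftrightarrow> \<bar>z\<bar> \<le> r *\<^sub>R u"
    using ex_order_unit by blast
  have "pos_cone x \<le> (norm h * norm x) *\<^sub>R u"
  proof (rule pos_cone_least)
    fix y assume y: "0 \<le> y" "y \<le> x"
    have "norm y \<le> norm x" using y by (intro lattice_norm) auto
    then have "norm (h y) \<le> norm h * norm x"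
      by (meson norm_blinfun mult_left_mono norm_ge_zero order_trans)
    then have "\<bar>h y\<bar> \<le> (norm h * norm x) *\<^sub>R u" using u by simp
    then show "h y \<le> (norm h * norm x) *\<^sub>R u" using abs_ge_self order_trans by blast
  qed (use assms in auto)
  then have "\<bar>pos_cone x\<bar> \<le> (norm h * norm x) *\<^sub>R u"
    using pos_cone_nonneg[OF assms] by simp
  then show ?thesis using u by simp
qed

definition pos_fun :: "'a \<Rightarrow> 'b"
  where "pos_fun x = pos_cone (pprt x) - pos_cone (- nprt x)"

lemma pos_fun_diff:
  assumes "0 \<le> a" "0 \<le> b"
  shows "pos_fun (a - b) = pos_cone a - pos_cone b"
proof -
  let ?x = "a - b"
  have "pprt ?x + b = a + (- nprt ?x)" using prts[of ?x] by (simp add: algebra_simps)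
  then have "pos_cone (pprt ?x) + pos_cone b = pos_cone a + pos_cone (- nprt ?x)"
    using assms by (metis pos_cone_add zero_le_pprt nprt_le_zero neg_0_le_iff_le)
  then show ?thesis by (simp add: pos_fun_def algebra_simps)
qed

lemma pos_fun_cone: "0 \<le> x \<Longrightarrow> pos_fun x = pos_cone x"
  using pos_fun_diff[of x 0] by (simp add: pos_cone_0)

lemma bounded_linear_pos_fun: "bounded_linear pos_fun"
proof (rule bounded_linear_intro)
  fix x y :: 'a and r :: real
  have x: "x = pprt x - (- nprt x)" and y: "y = pprt y - (- nprt y)"
    using prts[of x] prts[of y] by simp_all
  have "x + y = (pprt x + pprt y) - (- nprt x + - nprt y)" by (subst x, subst y) simp
  then have "pos_fun (x + y) = pos_cone (pprt x + pprt y) - pos_cone (- nprt x + - nprt y)"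
    by (simp only: pos_fun_diff add_nonneg_nonneg zero_le_pprt neg_0_le_iff_le nprt_le_zero)
  then show "pos_fun (x + y) = pos_fun x + pos_fun y"
    using pos_cone_add[of "pprt x" "pprt y"] pos_cone_add[of "- nprt x" "- nprt y"]
    by (simp add: pos_fun_def)
  have pos: "pos_fun (s *\<^sub>R x) = s *\<^sub>R pos_fun x" if "0 \<le> s" for s x
  proof -
    have "s *\<^sub>R x = s *\<^sub>R pprt x - s *\<^sub>R (- nprt x)"
      by (subst prts[of x]) (simp only: scaleR_add_right scaleR_minus_right diff_minus_eq_add)
    then have "pos_fun (s *\<^sub>R x) = pos_cone (s *\<^sub>R pprt x) - pos_cone (s *\<^sub>R (- nprt x))"
      using that pos_fun_diff[of "s *\<^sub>R pprt x" "s *\<^sub>R (- nprt x)"] scaleR_nonneg_nonneg[of s "- nprt x"]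
      by (simp add: scaleR_nonneg_nonneg)
    then show ?thesis
      using that pos_cone_scaleR[of "pprt x" s] pos_cone_scaleR[of "- nprt x" s]
      by (simp add: pos_fun_def scaleR_diff_right)
  qed
  have neg: "pos_fun (- x) = - pos_fun x" for x
    by (simp add: pos_fun_def pprt_neg nprt_neg)
  show "pos_fun (r *\<^sub>R x) = r *\<^sub>R pos_fun x"
  proof (cases "0 \<le> r")
    case False
    then have "pos_fun ((- r) *\<^sub>R x) = (- r) *\<^sub>R pos_fun x" by (intro pos) simp
    then show ?thesis using neg[of "r *\<^sub>R x"] by simp
  qed (rule pos)
  have "norm (pos_fun x) \<le> norm (pos_cone (pprt x)) + norm (pos_cone (- nprt x))"
    unfolding pos_fun_def by (rule norm_triangle_ineq4)
  also have "\<dots> \<le> norm h * norm (pprt x) + norm h * norm (- nprt x)"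
    by (intro add_mono pos_cone_norm) auto
  also have "\<dots> \<le> norm h * norm x + norm h * norm x"
    using norm_pprt_le[of x] norm_nprt_le[of x] by (intro add_mono mult_left_mono) auto
  finally show "norm (pos_fun x) \<le> norm x * (2 * norm h)" by simp
qed

text \<open>
  The positive part of an operator, by the Riesz-Kantorovich formula
  \<open>h\<^sup>+ x = Sup {h y | 0 \<le> y \<le> x}\<close> for \<open>x \<ge> 0\<close>.
\<close>

definition pos_part :: "'a \<Rightarrow>\<^sub>L 'b"
  where "pos_part = Blinfun pos_fun"

lemma pos_part_apply: "0 \<le> x \<Longrightarrow> pos_part x = Sup (blinfun_apply h ` {0..x})"
  by (simp add: pos_part_def bounded_linear_Blinfun_apply[OF bounded_linear_pos_fun]
      pos_fun_cone pos_cone_def)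

lemma pos_part_ge: "h \<le> pos_part" "0 \<le> pos_part"
  using pos_cone_upper pos_cone_nonneg
  by (auto simp: less_eq_blinfun_def pos_part_apply pos_cone_def)

lemma pos_part_le:
  assumes "h \<le> k" "0 \<le> k"
  shows "pos_part \<le> k"
  unfolding less_eq_blinfun_def
proof (intro allI impI)
  fix x :: 'a assume x: "0 \<le> x"
  have "pos_cone x \<le> k x"
  proof (rule pos_cone_least)
    fix y assume y: "0 \<le> y" "y \<le> x"
    have "h y \<le> k y" using assms y by (simp add: less_eq_blinfun_def)
    also have "0 \<le> k (x - y)"
      using assms(2) y unfolding less_eq_blinfun_def by (simp del: blinfun.diff_right)
    then have "k y \<le> k x" by (simp add: blinfun.diff_right)
    finally show "h y \<le> k x" .
  qed (rule x)
  then show "pos_part x \<le> k x" by (simp add: pos_part_apply[OF x] pos_cone_def)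
qed

end

instantiation blinfun :: (banach_lattice, dedekind_complete_AM_unit) banach_lattice
begin

definition sup_blinfun :: "('a \<Rightarrow>\<^sub>L 'b) \<Rightarrow> ('a \<Rightarrow>\<^sub>L 'b) \<Rightarrow> 'a \<Rightarrow>\<^sub>L 'b"
  where "sup_blinfun f g = g + pos_part (f - g)"

definition inf_blinfun :: "('a \<Rightarrow>\<^sub>L 'b) \<Rightarrow> ('a \<Rightarrow>\<^sub>L 'b) \<Rightarrow> 'a \<Rightarrow>\<^sub>L 'b"
  where "inf_blinfun f g = f - pos_part (f - g)"

definition abs_blinfun :: "('a \<Rightarrow>\<^sub>L 'b) \<Rightarrow> 'a \<Rightarrow>\<^sub>L 'b"
  where "abs_blinfun f = sup f (- f)"

instance
proof
  fix f g k :: "'a \<Rightarrow>\<^sub>L 'b"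
  note ge = pos_part_ge[of "f - g"]
  show sup1: "f \<le> sup f g" for f g :: "'a \<Rightarrow>\<^sub>L 'b"
    using pos_part_ge(1)[of "f - g"] by (simp add: sup_blinfun_def diff_le_eq add.commute)
  show sup2: "g \<le> sup f g" for f g :: "'a \<Rightarrow>\<^sub>L 'b"
    using pos_part_ge(2)[of "f - g"] by (simp add: sup_blinfun_def)
  show "sup f g \<le> k" if "f \<le> k" "g \<le> k"
    using pos_part_le[of "f - g" "k - g"] that
    by (simp add: sup_blinfun_def le_diff_eq add.commute)
  show "inf f g \<le> f" using ge(2) by (simp add: inf_blinfun_def diff_le_eq)
  show "inf f g \<le> g"
    using ge(1) by (simp add: inf_blinfun_def diff_le_eq add.commute)
  show "k \<le> inf f g" if "k \<le> f" "k \<le> g"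
    using pos_part_le[of "f - g" "f - k"] that
    by (simp add: inf_blinfun_def le_diff_eq diff_le_eq add.commute)
  show abs: "\<bar>f\<bar> = sup f (- f)" for f :: "'a \<Rightarrow>\<^sub>L 'b" by (rule abs_blinfun_def)
  assume le: "\<bar>f\<bar> \<le> \<bar>g\<bar>"
  obtain u :: 'b where u: "\<forall>r\<ge>0. \<forall>z. norm z \<le> r \<longleftrightarrow> \<bar>z\<bar> \<le> r *\<^sub>R u"
    using ex_order_unit by blast
  have g_le: "\<bar>g\<bar> x \<le> (norm g * norm x) *\<^sub>R u" if x: "0 \<le> x" for x
  proof -
    have "pos_cone (g - (- g)) x \<le> g x + (norm g * norm x) *\<^sub>R u"
    proof (rule pos_cone_least[OF x])
      fix y assume y: "0 \<le> y" "y \<le> x"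
      have "\<bar>y - (x - y)\<bar> \<le> \<bar>x\<bar>"
      proof (rule abs_leI)
        have "y - (x - y) \<le> y" using y by simp
        also have "\<dots> \<le> \<bar>x\<bar>" using y x by simp
        finally show "y - (x - y) \<le> \<bar>x\<bar>" .
        have "- (y - (x - y)) \<le> x - y" using y by simp
        also have "\<dots> \<le> \<bar>x\<bar>" using y x by simp
        finally show "- (y - (x - y)) \<le> \<bar>x\<bar>" .
      qed
      then have "norm (y - (x - y)) \<le> norm x" by (rule lattice_norm)
      then have "norm (g (y - (x - y))) \<le> norm g * norm x"
        by (meson norm_blinfun mult_left_mono norm_ge_zero order_trans)
      then have "\<bar>g (y - (x - y))\<bar> \<le> (norm g * norm x) *\<^sub>R u" using u by simp
      then have "g (y - (x - y)) \<le> (norm g * norm x) *\<^sub>R u" using abs_ge_self order_trans by blast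
      then show "(g - - g) y \<le> g x + (norm g * norm x) *\<^sub>R u"
        by (simp add: blinfun.diff_right blinfun.add_right blinfun.add_left algebra_simps)
    qed
    then show ?thesis
      using pos_part_apply[OF x, of "g - (- g)"]
      by (simp add: abs sup_blinfun_def pos_cone_def blinfun.add_left blinfun.diff_left blinfun.minus_left
          algebra_simps)
  qed
  have bound: "f' x \<le> (norm g * norm x) *\<^sub>R u" if f': "f' \<le> \<bar>f\<bar>" "- f' \<le> \<bar>f\<bar>" for f' x
  proof -
    have "f' (pprt x) \<le> \<bar>g\<bar> (pprt x)"
      using f'(1) le zero_le_pprt[of x] unfolding less_eq_blinfun_def by (meson order_trans)
    moreover have "(- f') (- nprt x) \<le> \<bar>g\<bar> (- nprt x)"
      using f'(2) le nprt_le_zero[of x] unfolding less_eq_blinfun_def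
      by (meson order_trans neg_0_le_iff_le)
    moreover have "f' x = f' (pprt x) + (- f') (- nprt x)"
      by (subst prts[of x]) (simp only: blinfun.add_right blinfun.minus_left blinfun.minus_right minus_minus)
    moreover have "\<bar>g\<bar> \<bar>x\<bar> = \<bar>g\<bar> (pprt x) + \<bar>g\<bar> (- nprt x)"
      unfolding abs_prts[of x] by (simp only: diff_conv_add_uminus blinfun.add_right)
    ultimately have "f' x \<le> \<bar>g\<bar> \<bar>x\<bar>" by (simp only: add_mono)
    also have "\<bar>g\<bar> \<bar>x\<bar> \<le> (norm g * norm x) *\<^sub>R u"
      using g_le[of "\<bar>x\<bar>"] by (simp add: norm_abs_lattice)
    finally show ?thesis .
  qed
  have "norm (f x) \<le> norm g * norm x" for x
  proof -
    have "f \<le> \<bar>f\<bar>" "- f \<le> \<bar>f\<bar>" using sup1[of f "- f"] sup2[of "- f" f] by (simp_all add: abs)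
    then have "\<bar>f x\<bar> \<le> (norm g * norm x) *\<^sub>R u"
      using bound[of f x] bound[of "- f" x] by (intro abs_leI) (simp_all add: blinfun.minus_left)
    then show ?thesis using u by simp
  qed
  then show "norm f \<le> norm g" by (intro norm_blinfun_bound) auto
qed

end


section \<open>Operators and Banach lattice properties\<close>

definition adjoint_op ::
  "('a::real_normed_vector \<Rightarrow>\<^sub>L 'b::real_normed_vector) \<Rightarrow> ('b \<Rightarrow>\<^sub>L real) \<Rightarrow>\<^sub>L ('a \<Rightarrow>\<^sub>L real)"
  where "adjoint_op T = Blinfun (\<lambda>\<phi>. \<phi> o\<^sub>L T)"

lemma adjoint_op_apply [simp]: "adjoint_op T \<phi> = \<phi> o\<^sub>L T"
  by (simp add: adjoint_op_def bounded_linear_Blinfun_apply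
      bounded_bilinear.bounded_linear_left[OF bounded_bilinear_blinfun_compose])

definition weakly_null :: "(nat \<Rightarrow> 'a::real_normed_vector) \<Rightarrow> bool"
  where "weakly_null x \<longleftrightarrow> (\<forall>\<phi> :: 'a \<Rightarrow>\<^sub>L real. (\<lambda>n. blinfun_apply \<phi> (x n)) \<longlonglongrightarrow> 0)"

definition weak_star_null :: "(nat \<Rightarrow> 'a::real_normed_vector \<Rightarrow>\<^sub>L real) \<Rightarrow> bool"
  where "weak_star_null \<phi> \<longleftrightarrow> (\<forall>x. (\<lambda>n. blinfun_apply (\<phi> n) x) \<longlonglongrightarrow> 0)"

definition disjoint_seq :: "(nat \<Rightarrow> 'a::banach_lattice) \<Rightarrow> bool"
  where "disjoint_seq x \<longleftrightarrow> (\<forall>m n. m \<noteq> n \<longrightarrow> inf \<bar>x m\<bar> \<bar>x n\<bar> = 0)"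

definition dunford_pettis :: "('a::banach \<Rightarrow>\<^sub>L 'b::banach) \<Rightarrow> bool"
  where "dunford_pettis T \<longleftrightarrow> (\<forall>x. weakly_null x \<longrightarrow> (\<lambda>n. blinfun_apply T (x n)) \<longlonglongrightarrow> 0)"

definition almost_dunford_pettis :: "('a::banach_lattice \<Rightarrow>\<^sub>L 'b::banach) \<Rightarrow> bool"
  where "almost_dunford_pettis T \<longleftrightarrow>
    (\<forall>x. disjoint_seq x \<and> weakly_null x \<longrightarrow> (\<lambda>n. blinfun_apply T (x n)) \<longlonglongrightarrow> 0)"

definition positively_limited :: "('a::banach \<Rightarrow>\<^sub>L 'b::banach_lattice) \<Rightarrow> bool"
  where "positively_limited T \<longleftrightarrow>
    (\<forall>\<phi>. (\<forall>n. 0 \<le> \<phi> n) \<and> weak_star_null \<phi> \<longrightarrow> (\<lambda>n. blinfun_apply (adjoint_op T) (\<phi> n)) \<longlonglongrightarrow> 0)"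

definition positive_schur :: "'a::banach_lattice itself \<Rightarrow> bool"
  where "positive_schur _ \<longleftrightarrow>
    (\<forall>x :: nat \<Rightarrow> 'a. (\<forall>n. 0 \<le> x n) \<and> weakly_null x \<longrightarrow> x \<longlonglongrightarrow> 0)"

definition dual_positive_schur :: "'a::banach_lattice itself \<Rightarrow> bool"
  where "dual_positive_schur _ \<longleftrightarrow>
    (\<forall>\<phi> :: nat \<Rightarrow> 'a \<Rightarrow>\<^sub>L real. (\<forall>n. 0 \<le> \<phi> n) \<and> weak_star_null \<phi> \<longrightarrow> \<phi> \<longlonglongrightarrow> 0)"

text \<open>
  Every net decreasing to \<open>0\<close> is norm null. The nets are the downward directed sets, indexed
  by themselves: the range of a decreasing net is such a set, with the same infimum, and by
  monotonicity of the norm one is norm null iff the other is.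
\<close>

definition order_continuous_norm :: "'a::banach_lattice itself \<Rightarrow> bool"
  where "order_continuous_norm _ \<longleftrightarrow>
    (\<forall>A :: 'a set.
      A \<noteq> {} \<and> (\<forall>a\<in>A. \<forall>b\<in>A. \<exists>c\<in>A. c \<le> a \<and> c \<le> b) \<and>
      (\<forall>a\<in>A. 0 \<le> a) \<and> (\<forall>l. (\<forall>a\<in>A. l \<le> a) \<longrightarrow> l \<le> 0) \<longrightarrow>
      (\<forall>\<epsilon>>0. \<exists>a\<in>A. \<forall>b\<in>A. b \<le> a \<longrightarrow> norm b < \<epsilon>))"

end

theory Submission
  imports Defs
begin

text \<open>
  Both parts are proved by contraposition, from one construction. Suppose that the norm of the dual
  of \<open>E\<close> is not order continuous. Then the dual contains positive functionals \<open>\<phi> n\<close>, bounded below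
  in norm by some \<open>\<delta> > 0\<close>, whose partial sums lie below a fixed functional
  (\<open>not_order_continuous_norm_order_summable\<close>). So \<open>x \<mapsto> (\<phi> n x)\<close> is a positive bounded operator
  from \<open>E\<close> to \<open>\<ell>\<^sup>1\<close>, and for positive \<open>y n\<close> in the unit ball of \<open>F\<close> the formula
  \<open>T x = (\<Sum>n. \<phi> n x y n)\<close> defines a positive operator that factors through \<open>\<ell>\<^sup>1\<close>. By Schur's theorem
  (\<open>schur_l1\<close>) it is Dunford-Pettis. Its adjoint satisfies \<open>T* g \<ge> g (y n) \<phi> n\<close> for all positive
  \<open>g\<close>. Given any positive sequence \<open>g n\<close> in the dual of \<open>F\<close>, one may choose the \<open>y n\<close> so that they
  almost realise the norms of the \<open>g n\<close>; then the norm of \<open>T* (g n)\<close> is at least \<open>\<delta> / 2\<close> times that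
  of \<open>g n\<close> (\<open>exists_dunford_pettis_detecting_norm_null\<close>).

  For (b) this applies directly to a positive weak* null sequence that is not norm null. For (a) the
  sequence \<open>g n\<close> has to be disjoint and weakly null, so a positive weakly null sequence \<open>x n\<close> in the
  dual of \<open>F\<close> that is not norm null must first be made disjoint
  (\<open>not_positive_schur_dual_disjoint\<close>). After passing to a subsequence this is done by the
  truncations \<open>(x k - M k (\<Sum>i<k. x i) - \<rho>)\<^sup>+\<close> with suitable \<open>M k\<close> and \<open>\<rho>\<close>: they are weakly null
  because they are dominated by \<open>x k\<close>, and the difficulty is to keep their norms away from \<open>0\<close>.
  If the \<open>x n\<close> escape every order interval, the subsequence can be chosen greedily. Otherwise they
  may be taken to lie in one order interval, and a weak* cluster point, in the bidual of \<open>F\<close>, of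
  the vectors at which the \<open>x n\<close> are large guides the choice.
\<close>

section \<open>Limits and order in Banach lattices\<close>

text \<open>
  The cone is closed because the negative part is dominated by the distance to the cone: if
  \<open>X n \<ge> 0\<close>, then \<open>- x \<le> X n - x\<close>, so \<open>x\<^sup>-\<close> lies below \<open>\<bar>X n - x\<bar>\<close>.
\<close>

lemma banach_lattice_tendsto_nonneg:
  fixes x :: "'a::banach_lattice"
  assumes lim: "X \<longlonglongrightarrow> x" and nonneg: "\<And>n. 0 \<le> X n"
  shows "0 \<le> x"
proof -
  have "norm (nprt x) \<le> norm (X n - x)" for n
  proof (rule lattice_norm)
    have "- x \<le> X n - x" using nonneg[of n] by simp
    then have "- nprt x \<le> \<bar>X n - x\<bar>"
      by (metis abs_ge_self abs_ge_zero order_trans pprt_neg pprt_def sup_least)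
    then show "\<bar>nprt x\<bar> \<le> \<bar>X n - x\<bar>" by simp
  qed
  moreover have "(\<lambda>n. norm (X n - x)) \<longlonglongrightarrow> 0"
    using lim tendsto_norm_zero LIM_zero by blast
  ultimately have "norm (nprt x) \<le> 0"
    using LIMSEQ_le_const by blast
  then show ?thesis by (simp add: zero_le_iff_zero_nprt)
qed

lemma banach_lattice_tendsto_le:
  fixes x z :: "'a::banach_lattice"
  assumes "X \<longlonglongrightarrow> x" and "\<And>n. X n \<le> z"
  shows "x \<le> z"
  using banach_lattice_tendsto_nonneg[of "\<lambda>n. z - X n" "z - x"] assms
  by (simp add: tendsto_diff)

lemma banach_lattice_suminf_nonneg:
  fixes f :: "nat \<Rightarrow> 'a::banach_lattice"
  assumes "summable f" and "\<And>n. 0 \<le> f n"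
  shows "0 \<le> suminf f"
  using banach_lattice_tendsto_nonneg[OF summable_LIMSEQ[OF assms(1)]] assms(2)
  by (simp add: sum_nonneg)

lemma banach_lattice_le_suminf:
  fixes f :: "nat \<Rightarrow> 'a::banach_lattice"
  assumes "summable f" and "\<And>n. 0 \<le> f n"
  shows "f i \<le> suminf f"
proof -
  have "0 \<le> (\<Sum>n. f (n + Suc i))"
    using assms by (intro banach_lattice_suminf_nonneg) (auto simp: summable_ignore_initial_segment simp del: add_Suc_right)
  moreover have "suminf f = (\<Sum>n. f (n + Suc i)) + (\<Sum>n<Suc i. f n)"
    using assms(1) by (rule suminf_split_initial_segment)
  moreover have "f i \<le> (\<Sum>n<Suc i. f n)"
    using assms(2) by (simp add: sum_nonneg)
  ultimately show ?thesis by (metis add_increasing order_trans)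
qed

lemma inf_pprt_nprt: "inf (pprt a) (- nprt (a :: 'a::lattice_ab_group_add)) = 0"
proof -
  have "nprt a = a - pprt a" using prts[of a] by (metis add_diff_cancel_left')
  then have "inf (pprt a) (- nprt a) = inf (pprt a + 0) (pprt a + - a)" by simp
  also have "\<dots> = pprt a + inf 0 (- a)" by (rule add_inf_distrib_left[symmetric])
  also have "inf 0 (- a) = - pprt a" by (simp add: pprt_def neg_sup_eq_inf inf_commute)
  finally show ?thesis by simp
qed

lemma blinfun_nonneg: "0 \<le> T \<Longrightarrow> 0 \<le> x \<Longrightarrow> 0 \<le> blinfun_apply T x"
  for T :: "'a::banach_lattice \<Rightarrow>\<^sub>L 'b::banach_lattice"
  by (simp add: less_eq_blinfun_def)

lemma blinfun_mono: "0 \<le> T \<Longrightarrow> x \<le> y \<Longrightarrow> blinfun_apply T x \<le> blinfun_apply T y"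
  for T :: "'a::banach_lattice \<Rightarrow>\<^sub>L 'b::banach_lattice"
  using blinfun_nonneg[of T "y - x"] by (simp add: blinfun.diff_right)

lemma abs_blinfun_le: "0 \<le> T \<Longrightarrow> \<bar>blinfun_apply T x\<bar> \<le> blinfun_apply T \<bar>x\<bar>"
  for T :: "'a::banach_lattice \<Rightarrow>\<^sub>L 'b::banach_lattice"
  using blinfun_mono[of T x "\<bar>x\<bar>", OF _ abs_ge_self]
    blinfun_mono[of T "- x" "\<bar>x\<bar>", OF _ abs_ge_minus_self]
  by (simp add: abs_leI blinfun.minus_right)

text \<open>
  Weak convergence to \<open>0\<close> passes to positive minorants, because every functional is dominated
  by its modulus, a positive functional. All the sequences constructed below are weakly null
  for this reason.
\<close>

lemma weakly_null_dominated:
  fixes x z :: "nat \<Rightarrow> 'a::banach_lattice"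
  assumes x: "weakly_null x" and z: "\<And>n. 0 \<le> z n" "\<And>n. z n \<le> x n"
  shows "weakly_null z"
  unfolding weakly_null_def
proof
  fix \<phi> :: "'a \<Rightarrow>\<^sub>L real"
  have "\<phi> \<le> \<bar>\<phi>\<bar>" "- \<phi> \<le> \<bar>\<phi>\<bar>" by (rule abs_ge_self, rule abs_ge_minus_self)
  then have "\<bar>\<phi> (z n)\<bar> \<le> \<bar>\<phi>\<bar> (z n)" for n
    using z(1)[of n] by (intro abs_leI) (auto simp: less_eq_blinfun_def blinfun.minus_left)
  also have "\<bar>\<phi>\<bar> (z n) \<le> \<bar>\<phi>\<bar> (x n)" for n
    using z(2) by (intro blinfun_mono) auto
  finally have "norm (\<phi> (z n)) \<le> \<bar>\<phi>\<bar> (x n)" for n by simp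
  moreover have "(\<lambda>n. \<bar>\<phi>\<bar> (x n)) \<longlonglongrightarrow> 0"
    using x by (simp add: weakly_null_def)
  ultimately show "(\<lambda>n. \<phi> (z n)) \<longlonglongrightarrow> 0"
    by (rule Lim_null_comparison[OF always_eventually[OF allI]])
qed

lemma weakly_null_subseq:
  fixes x :: "nat \<Rightarrow> 'a::real_normed_vector"
  assumes "weakly_null x" "strict_mono r"
  shows "weakly_null (\<lambda>k. x (r k))"
  unfolding weakly_null_def
proof
  fix \<phi> :: "'a \<Rightarrow>\<^sub>L real"
  have "(\<lambda>n. \<phi> (x n)) \<longlonglongrightarrow> 0" using assms(1) by (simp add: weakly_null_def)
  then show "(\<lambda>k. \<phi> (x (r k))) \<longlonglongrightarrow> 0"
    using LIMSEQ_subseq_LIMSEQ[OF _ assms(2)] by (fastforce simp: comp_def)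
qed

lemma positive_functional_nearly_attains_norm:
  fixes f :: "'a::banach_lattice \<Rightarrow>\<^sub>L real"
  assumes f: "0 \<le> f" and c: "0 \<le> c" "c < norm f"
  obtains y where "0 \<le> y" "norm y \<le> 1" "c < f y"
proof -
  obtain x where x: "c * norm x < norm (f x)"
    using norm_blinfun_bound[OF c(1), of f] c(2) by (meson not_le)
  then have nz: "norm x > 0" using c(1) by (cases "x = 0") auto
  have "c * norm x < f \<bar>x\<bar>" using x abs_blinfun_le[OF f, of x] by simp
  then have "c < f (inverse (norm x) *\<^sub>R \<bar>x\<bar>)"
    using nz by (simp add: blinfun.scaleR_right field_simps)
  moreover have "0 \<le> inverse (norm x) *\<^sub>R \<bar>x\<bar>" by (simp add: scaleR_nonneg_nonneg)
  moreover have "norm (inverse (norm x) *\<^sub>R \<bar>x\<bar>) \<le> 1"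
    using nz by (simp add: norm_abs_lattice)
  ultimately show ?thesis using that by blast
qed

section \<open>Failure of order continuity of the norm\<close>

text \<open>
  Take a set directed downwards to \<open>0\<close> whose norms do not tend to \<open>0\<close>. If one could descend in
  it to points below which all steps are arbitrarily small, the set would be a Cauchy net; its
  limit is a lower bound, hence \<open>0\<close>, so the norms would tend to \<open>0\<close> after all.
\<close>

lemma not_order_continuous_norm_large_steps:
  assumes "\<not> order_continuous_norm TYPE('a::banach_lattice)"
  obtains A :: "'a::banach_lattice set" and \<delta> :: real where "A \<noteq> {}" "\<And>a. a \<in> A \<Longrightarrow> 0 \<le> a" "\<delta> > 0"
    "\<And>a. a \<in> A \<Longrightarrow> \<exists>b\<in>A. b \<le> a \<and> norm (a - b) \<ge> \<delta>"
proof -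
  obtain A :: "'a set" where A0: "A \<noteq> {}" "\<forall>a\<in>A. \<forall>b\<in>A. \<exists>c\<in>A. c \<le> a \<and> c \<le> b"
      "\<forall>a\<in>A. 0 \<le> a" "\<forall>l. (\<forall>a\<in>A. l \<le> a) \<longrightarrow> l \<le> 0"
    and "\<exists>\<epsilon>>0. \<not> (\<exists>a\<in>A. \<forall>b\<in>A. b \<le> a \<longrightarrow> norm b < \<epsilon>)"
    using assms unfolding order_continuous_norm_def not_all not_imp by (elim exE conjE) blast
  then obtain \<epsilon> :: real where \<epsilon>: "\<epsilon> > 0" "\<And>a. a \<in> A \<Longrightarrow> \<exists>b\<in>A. b \<le> a \<and> \<not> norm b < \<epsilon>"
    by blast
  note A = A0(1) A0(2)[rule_format] A0(3)[rule_format] A0(4)[rule_format]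
  have "\<exists>\<delta>>0. \<forall>a\<in>A. \<exists>b\<in>A. b \<le> a \<and> norm (a - b) \<ge> \<delta>"
  proof (rule ccontr)
    assume "\<not> ?thesis"
    then have "\<forall>n. \<exists>a\<in>A. \<forall>b\<in>A. b \<le> a \<longrightarrow> norm (a - b) < inverse (real (Suc n))"
      by (metis inverse_positive_iff_positive not_less of_nat_0_less_iff zero_less_Suc)
    then obtain c where c: "\<And>n. c n \<in> A"
      and near: "\<And>n b. b \<in> A \<Longrightarrow> b \<le> c n \<Longrightarrow> norm (c n - b) < inverse (real (Suc n))"
      by metis
    have "Cauchy c"
    proof (rule metric_CauchyI)
      fix e :: real assume "e > 0"
      then obtain N where N: "inverse (real (Suc N)) < e / 2"
        using reals_Archimedean[of "e / 2"] by auto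
      have small: "inverse (real (Suc n)) < e / 2" if "n \<ge> N" for n
      proof -
        have "inverse (real (Suc n)) \<le> inverse (real (Suc N))" using that by (simp add: le_imp_inverse_le)
        then show ?thesis using N by linarith
      qed
      have "dist (c m) (c n) < e" if "m \<ge> N" "n \<ge> N" for m n
      proof -
        obtain d where d: "d \<in> A" "d \<le> c m" "d \<le> c n" using A(2) c by blast
        have "dist (c m) (c n) \<le> norm (c m - d) + norm (c n - d)"
          by (metis dist_norm dist_triangle2)
        also have "\<dots> < e"
          using near[OF d(1,2)] near[OF d(1,3)] small[OF that(1)] small[OF that(2)] by linarith
        finally show ?thesis .
      qed
      then show "\<exists>M. \<forall>m\<ge>M. \<forall>n\<ge>M. dist (c m) (c n) < e" by blast
    qed
    then obtain l where l: "c \<longlonglongrightarrow> l" using Cauchy_convergent convergent_def by blast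
    have "l \<le> a" if a: "a \<in> A" for a
    proof -
      have "\<forall>n. \<exists>d\<in>A. d \<le> c n \<and> d \<le> a" using A(2) c a by blast
      then obtain d where d: "\<And>n. d n \<in> A" "\<And>n. d n \<le> c n" "\<And>n. d n \<le> a" by metis
      have "norm (c n - d n) \<le> inverse (real (Suc n))" for n
        using near[OF d(1,2)] by (simp add: less_imp_le)
      then have "(\<lambda>n. c n - d n) \<longlonglongrightarrow> 0"
        by (intro Lim_null_comparison[OF _ LIMSEQ_inverse_real_of_nat]) auto
      then have "d \<longlonglongrightarrow> l" using tendsto_diff[OF l, of "\<lambda>n. c n - d n" 0] by simp
      then show ?thesis using d(3) by (rule banach_lattice_tendsto_le)
    qed
    then have "l \<le> 0" using A(4) by blast
    moreover have "0 \<le> l" by (rule banach_lattice_tendsto_nonneg[OF l A(3)[OF c]])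
    ultimately have "c \<longlonglongrightarrow> 0" using l by simp
    moreover have "\<epsilon> \<le> norm (c n)" for n
    proof -
      obtain b where b: "b \<in> A" "b \<le> c n" "\<not> norm b < \<epsilon>" using \<epsilon>(2) c by blast
      then have "norm b \<le> norm (c n)" using A(3) c by (intro lattice_norm) simp
      then show ?thesis using b(3) by simp
    qed
    ultimately show False
      using \<epsilon>(1) LIMSEQ_le_const[OF tendsto_norm[of c 0]] by force
  qed
  then show ?thesis using A(1,3) that by blast
qed

text \<open>
  The differences along a decreasing sequence with large steps: their sums telescope,
  so the first term of the decreasing sequence bounds them.
\<close>

lemma not_order_continuous_norm_order_summable:
  assumes "\<not> order_continuous_norm TYPE('a::banach_lattice)"
  obtains \<phi> :: "nat \<Rightarrow> 'a::banach_lattice" and \<psi> :: 'a and \<delta> :: real where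
    "\<And>n. 0 \<le> \<phi> n" "\<And>N. (\<Sum>n<N. \<phi> n) \<le> \<psi>" "\<delta> > 0" "\<And>n. \<delta> \<le> norm (\<phi> n)"
proof -
  obtain A :: "'a set" and \<delta> where A: "A \<noteq> {}" "\<And>a. a \<in> A \<Longrightarrow> 0 \<le> a" and \<delta>: "\<delta> > 0"
    and step: "\<And>a. a \<in> A \<Longrightarrow> \<exists>b\<in>A. b \<le> a \<and> norm (a - b) \<ge> \<delta>"
    using not_order_continuous_norm_large_steps[OF assms] by metis
  obtain b where b: "\<And>n. b n \<in> A" and dec: "\<And>n. b (Suc n) \<le> b n \<and> norm (b n - b (Suc n)) \<ge> \<delta>"
    using dependent_nat_choice[of "\<lambda>_ a. a \<in> A" "\<lambda>_ a b. b \<le> a \<and> norm (a - b) \<ge> \<delta>"] A(1) step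
    by (metis all_not_in_conv)
  have "(\<Sum>n<N. b n - b (Suc n)) \<le> b 0" for N
    using A(2)[OF b[of N]] by (simp add: sum_lessThan_telescope')
  then show ?thesis
    using that[of "\<lambda>n. b n - b (Suc n)" "b 0" \<delta>] dec \<delta> by simp
qed

section \<open>Schur's theorem and operators through sequences of functionals\<close>

text \<open>
  Schur's theorem that weakly null sequences in \<open>\<ell>\<^sup>1\<close> are norm null, for a sequence given by
  its matrix of coordinates. The proof is the gliding hump. If infinitely many rows had norm at
  least \<open>\<epsilon>\<close>, then a subsequence of rows would carry all but \<open>2 \<epsilon> / 5\<close> of its mass on
  consecutive disjoint blocks of columns, since the coordinates tend to \<open>0\<close>. A single sign
  sequence which is right on all blocks pairs with each of these rows to at least \<open>\<epsilon> / 5\<close>.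
\<close>

lemma schur_l1:
  fixes a :: "nat \<Rightarrow> nat \<Rightarrow> real"
  assumes summ: "\<And>k. summable (\<lambda>n. \<bar>a k n\<bar>)"
    and weak: "\<And>s. (\<And>n. \<bar>s n\<bar> \<le> 1) \<Longrightarrow> (\<lambda>k. \<Sum>n. s n * a k n) \<longlonglongrightarrow> 0"
  shows "(\<lambda>k. \<Sum>n. \<bar>a k n\<bar>) \<longlonglongrightarrow> 0"
proof (rule ccontr)
  let ?S = "\<lambda>k. \<Sum>n. \<bar>a k n\<bar>"
  assume "\<not> ?thesis"
  then obtain \<epsilon> where \<epsilon>: "\<epsilon> > 0" and often: "\<And>K. \<exists>k\<ge>K. \<epsilon> \<le> ?S k"
    unfolding lim_sequentially dist_real_def
    using suminf_nonneg[OF summ] by (simp add: not_less) blast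
  have coord: "(\<lambda>k. a k n) \<longlonglongrightarrow> 0" for n
  proof -
    have "(\<Sum>i. of_bool (i = n) * a k i) = a k n" for k
      using suminf_finite[of "{n}" "\<lambda>i. of_bool (i = n) * a k i"] by simp
    then show ?thesis using weak[of "\<lambda>i. of_bool (i = n)"] by simp
  qed
  have head: "\<exists>k>K. \<epsilon> \<le> ?S k \<and> (\<Sum>n<N. \<bar>a k n\<bar>) < \<epsilon> / 5" for K N
  proof -
    have "(\<lambda>k. \<Sum>n<N. \<bar>a k n\<bar>) \<longlonglongrightarrow> (\<Sum>n<N. 0)"
      by (intro tendsto_sum tendsto_rabs_zero coord)
    then have "eventually (\<lambda>k. (\<Sum>n<N. \<bar>a k n\<bar>) < \<epsilon> / 5) sequentially"
      using \<epsilon> by (intro order_tendstoD(2)[where y = 0]) auto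
    then obtain K' where K': "\<And>k. k \<ge> K' \<Longrightarrow> (\<Sum>n<N. \<bar>a k n\<bar>) < \<epsilon> / 5"
      by (auto simp: eventually_sequentially)
    obtain k where "k \<ge> max K' (Suc K)" "\<epsilon> \<le> ?S k" using often by blast
    then show ?thesis using K' by (intro exI[of _ k]) auto
  qed
  have tail: "\<exists>N'>N. ?S k - (\<Sum>n<N'. \<bar>a k n\<bar>) < \<epsilon> / 5" for k N
  proof -
    have "(\<lambda>N. \<Sum>n<N. \<bar>a k n\<bar>) \<longlonglongrightarrow> ?S k" by (rule summable_LIMSEQ[OF summ])
    then have "eventually (\<lambda>N. ?S k - \<epsilon> / 5 < (\<Sum>n<N. \<bar>a k n\<bar>)) sequentially"
      using \<epsilon> by (intro order_tendstoD(1)[where y = "?S k"]) auto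
    then obtain N0 where N0: "\<And>N. N \<ge> N0 \<Longrightarrow> ?S k - \<epsilon> / 5 < (\<Sum>n<N. \<bar>a k n\<bar>)"
      by (auto simp: eventually_sequentially)
    show ?thesis using N0[of "max N0 (Suc N)"] by (intro exI[of _ "max N0 (Suc N)"]) auto
  qed
  \<comment> \<open>The state is a pair of a row and the column at which the next block begins.\<close>
  define step where "step p q \<longleftrightarrow> fst p < fst q \<and> snd p < snd q \<and> \<epsilon> \<le> ?S (fst q) \<and>
      (\<Sum>n<snd p. \<bar>a (fst q) n\<bar>) < \<epsilon> / 5 \<and> ?S (fst q) - (\<Sum>n<snd q. \<bar>a (fst q) n\<bar>) < \<epsilon> / 5"
    for p q :: "nat \<times> nat"
  have "\<exists>q. step p q" for p
  proof -
    obtain k where k: "k > fst p" "\<epsilon> \<le> ?S k" "(\<Sum>n<snd p. \<bar>a k n\<bar>) < \<epsilon> / 5"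
      using head by blast
    obtain N' where "N' > snd p" "?S k - (\<Sum>n<N'. \<bar>a k n\<bar>) < \<epsilon> / 5" using tail by blast
    with k have "step p (k, N')" by (simp add: step_def)
    then show ?thesis by blast
  qed
  then obtain p where p0: "p 0 = (0, 0)" and p: "\<And>j. step (p j) (p (Suc j))"
    using dependent_nat_choice[of "\<lambda>j q. j = 0 \<longrightarrow> q = (0, 0)" "\<lambda>_. step"] by auto
  define k N where "k j = fst (p j)" and "N j = snd (p j)" for j
  have k_mono: "strict_mono k" and N_mono: "strict_mono N"
    using p by (auto simp: strict_mono_Suc_iff k_def N_def step_def)
  have big: "\<epsilon> \<le> ?S (k (Suc j))"
    and headj: "(\<Sum>n<N j. \<bar>a (k (Suc j)) n\<bar>) < \<epsilon> / 5"
    and tailj: "?S (k (Suc j)) - (\<Sum>n<N (Suc j). \<bar>a (k (Suc j)) n\<bar>) < \<epsilon> / 5" for j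
    using p[of j] by (simp_all add: step_def k_def N_def)
  \<comment> \<open>The index of the block that contains column \<open>n\<close>.\<close>
  define block where "block n = (LEAST j. n < N (Suc j))" for n
  have block: "block n = j" if "N j \<le> n" "n < N (Suc j)" for n j
    unfolding block_def
  proof (rule Least_equality)
    fix i assume "n < N (Suc i)"
    then have "N j < N (Suc i)" using that by simp
    then show "j \<le> i" using strict_mono_less[OF N_mono] by simp
  qed (rule that)
  define s where "s n = sgn (a (k (Suc (block n))) n)" for n
  have s1: "\<bar>s n\<bar> \<le> 1" for n by (simp add: s_def sgn_if)
  have lower: "\<epsilon> / 5 \<le> (\<Sum>n. s n * a (k (Suc j)) n)" for j
  proof -
    define b where "b n = a (k (Suc j)) n" for n
    have sb: "summable (\<lambda>n. \<bar>b n\<bar>)" using summ by (simp add: b_def)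
    have le: "\<bar>s n * b n\<bar> \<le> \<bar>b n\<bar>" for n
      using s1[of n] by (simp add: abs_mult mult_left_le_one_le)
    have "summable (\<lambda>n. \<bar>s n * b n\<bar>)"
      by (rule summable_comparison_test[OF _ sb]) (use le in auto)
    then have ssb: "summable (\<lambda>n. s n * b n)" by (rule summable_rabs_cancel)
    \<comment> \<open>The signs are right on block \<open>j\<close>. Elsewhere the pairing is at worst the negative of the mass,
        which costs twice the mass before and after the block.\<close>
    have pw: "\<bar>b n\<bar> - (if n < N j then 2 * \<bar>b n\<bar> else 0) - (if n < N (Suc j) then 0 else 2 * \<bar>b n\<bar>)
        \<le> s n * b n" for n
    proof (cases "N j \<le> n \<and> n < N (Suc j)")
      case True
      then have "s n * b n = \<bar>b n\<bar>" using block[of j n] by (simp add: s_def b_def abs_sgn mult.commute)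
      then show ?thesis using True by simp
    next
      case False
      then show ?thesis using le[of n] strict_mono_less[OF N_mono, of j "Suc j"] by auto
    qed
    have h: "(\<lambda>n. if n < N j then 2 * \<bar>b n\<bar> else 0) sums (\<Sum>n<N j. 2 * \<bar>b n\<bar>)"
      using sums_If_finite_set[of "{..<N j}" "\<lambda>n. 2 * \<bar>b n\<bar>"] by simp
    have h': "(\<lambda>n. if n < N (Suc j) then 2 * \<bar>b n\<bar> else 0) sums (\<Sum>n<N (Suc j). 2 * \<bar>b n\<bar>)"
      using sums_If_finite_set[of "{..<N (Suc j)}" "\<lambda>n. 2 * \<bar>b n\<bar>"] by simp
    have all: "(\<lambda>n. \<bar>b n\<bar>) sums ?S (k (Suc j))" using sb by (simp add: b_def summable_sums)
    have t: "(\<lambda>n. if n < N (Suc j) then 0 else 2 * \<bar>b n\<bar>) sums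
        (2 * ?S (k (Suc j)) - (\<Sum>n<N (Suc j). 2 * \<bar>b n\<bar>))"
      by (rule sums_cong[THEN iffD1, OF _ sums_diff[OF sums_mult[OF all, of 2] h']]) simp
    have "?S (k (Suc j)) - (\<Sum>n<N j. 2 * \<bar>b n\<bar>)
        - (2 * ?S (k (Suc j)) - (\<Sum>n<N (Suc j). 2 * \<bar>b n\<bar>)) \<le> (\<Sum>n. s n * b n)"
      by (rule sums_le[OF pw sums_diff[OF sums_diff[OF all h] t] summable_sums[OF ssb]])
    then show ?thesis
      using big[of j] headj[of j] tailj[of j]
      unfolding sum_distrib_left[symmetric] b_def by linarith
  qed
  have "(\<lambda>j. \<Sum>n. s n * a (k (Suc j)) n) \<longlonglongrightarrow> 0"
    using LIMSEQ_subseq_LIMSEQ[OF weak[OF s1] k_mono, THEN LIMSEQ_Suc] by (simp add: comp_def)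
  then have "\<epsilon> / 5 \<le> 0" using lower by (intro LIMSEQ_le_const) auto
  then show False using \<epsilon> by simp
qed

text \<open>
  The composition of \<open>x \<mapsto> (\<phi> n x)\<close>, as a map into \<open>\<ell>\<^sup>1\<close>, with the operator on \<open>\<ell>\<^sup>1\<close> that sends the
  unit vectors to the \<open>y n\<close>.
\<close>

definition l1_operator :: "(nat \<Rightarrow> 'a::real_normed_vector \<Rightarrow>\<^sub>L real) \<Rightarrow> (nat \<Rightarrow> 'b::banach) \<Rightarrow> 'a \<Rightarrow>\<^sub>L 'b"
  where "l1_operator \<phi> y = Blinfun (\<lambda>x. \<Sum>n. \<phi> n x *\<^sub>R y n)"

context
  fixes \<phi> :: "nat \<Rightarrow> 'a::banach_lattice \<Rightarrow>\<^sub>L real" and \<psi> :: "'a \<Rightarrow>\<^sub>L real"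
  assumes pos: "\<And>n. 0 \<le> \<phi> n" and bound: "\<And>N. (\<Sum>n<N. \<phi> n) \<le> \<psi>"
begin

text \<open>
  As \<open>\<bar>\<phi> n x\<bar> \<le> \<phi> n \<bar>x\<bar>\<close>, the order bound \<open>\<psi>\<close> of the partial sums shows that \<open>x \<mapsto> (\<phi> n x)\<close>
  is bounded from \<open>'a\<close> into \<open>\<ell>\<^sup>1\<close>, with norm at most \<open>norm \<psi>\<close>.
\<close>

lemma l1_sum_le: "(\<Sum>n<N. \<bar>\<phi> n x\<bar>) \<le> norm \<psi> * norm x"
proof -
  have "(\<Sum>n<N. \<bar>\<phi> n x\<bar>) \<le> (\<Sum>n<N. \<phi> n \<bar>x\<bar>)"
    by (intro sum_mono abs_blinfun_le pos)
  also have "\<dots> = (\<Sum>n<N. \<phi> n) \<bar>x\<bar>" by (simp add: blinfun.sum_left)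
  also have "\<dots> \<le> \<psi> \<bar>x\<bar>" using bound[of N] by (simp add: less_eq_blinfun_def)
  also have "\<dots> \<le> norm \<psi> * norm x"
    using norm_blinfun[of \<psi> "\<bar>x\<bar>"] by (simp add: norm_abs_lattice)
  finally show ?thesis .
qed

lemma l1_summable: "summable (\<lambda>n. \<bar>\<phi> n x\<bar>)"
  by (rule bounded_imp_summable[of _ "norm \<psi> * norm x"])
    (use l1_sum_le[of x "Suc _"] in \<open>simp_all add: lessThan_Suc_atMost\<close>)

lemma l1_suminf_le: "(\<Sum>n. \<bar>\<phi> n x\<bar>) \<le> norm \<psi> * norm x"
  by (rule suminf_le_const[OF l1_summable l1_sum_le])

context
  fixes y :: "nat \<Rightarrow> 'b::banach"
  assumes y: "\<And>n. norm (y n) \<le> 1"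
begin

lemma l1_term_le: "norm (\<phi> n x *\<^sub>R y n) \<le> \<bar>\<phi> n x\<bar>"
  using y[of n] by (simp add: mult_left_le)

lemma l1_operator_summable: "summable (\<lambda>n. \<phi> n x *\<^sub>R y n)"
  by (rule summable_comparison_test[OF _ l1_summable[of x]]) (use l1_term_le in blast)

lemma l1_operator_norm_le: "norm (\<Sum>n. \<phi> n x *\<^sub>R y n) \<le> (\<Sum>n. \<bar>\<phi> n x\<bar>)"
  by (rule norm_suminf_le[OF l1_term_le l1_summable])

lemma l1_operator_apply: "l1_operator \<phi> y x = (\<Sum>n. \<phi> n x *\<^sub>R y n)"
proof -
  have "bounded_linear (\<lambda>x. \<Sum>n. \<phi> n x *\<^sub>R y n)"
  proof (rule bounded_linear_intro)
    fix u v :: 'a and r :: real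
    show "(\<Sum>n. \<phi> n (u + v) *\<^sub>R y n) = (\<Sum>n. \<phi> n u *\<^sub>R y n) + (\<Sum>n. \<phi> n v *\<^sub>R y n)"
      by (simp add: blinfun.add_right scaleR_add_left suminf_add[OF l1_operator_summable l1_operator_summable])
    show "(\<Sum>n. \<phi> n (r *\<^sub>R u) *\<^sub>R y n) = r *\<^sub>R (\<Sum>n. \<phi> n u *\<^sub>R y n)"
      using suminf_scaleR_right[OF l1_operator_summable[of u], of r] by (simp add: blinfun.scaleR_right)
    show "norm (\<Sum>n. \<phi> n u *\<^sub>R y n) \<le> norm u * norm \<psi>"
      using l1_operator_norm_le[of u] l1_suminf_le[of u] by (simp add: mult.commute)
  qed
  then show ?thesis by (simp add: l1_operator_def bounded_linear_Blinfun_apply)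
qed

end

text \<open>
  The operator factors through \<open>\<ell>\<^sup>1\<close>, where weakly null sequences are norm null. To apply Schur's
  theorem, each bounded scalar sequence \<open>s\<close> has to give a bounded functional
  \<open>\<lambda>x. \<Sum>n. s n * \<phi> n x\<close>, which is again an operator of the same kind, with values in
  \<^typ>\<open>real\<close>.
\<close>

lemma dunford_pettis_l1_operator:
  fixes y :: "nat \<Rightarrow> 'b::banach"
  assumes y: "\<And>n. norm (y n) \<le> 1"
  shows "dunford_pettis (l1_operator \<phi> y)"
  unfolding dunford_pettis_def
proof (intro allI impI)
  fix x :: "nat \<Rightarrow> 'a" assume x: "weakly_null x"
  have "(\<lambda>k. \<Sum>n. \<bar>\<phi> n (x k)\<bar>) \<longlonglongrightarrow> 0"
  proof (rule schur_l1[OF l1_summable])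
    fix s :: "nat \<Rightarrow> real" assume s: "\<And>n. \<bar>s n\<bar> \<le> 1"
    have "(\<lambda>k. l1_operator \<phi> s (x k)) \<longlonglongrightarrow> 0" using x unfolding weakly_null_def by blast
    then show "(\<lambda>k. \<Sum>n. s n * \<phi> n (x k)) \<longlonglongrightarrow> 0"
      using s by (simp add: l1_operator_apply mult.commute)
  qed
  moreover have "norm (l1_operator \<phi> y (x k)) \<le> (\<Sum>n. \<bar>\<phi> n (x k)\<bar>)" for k
    using l1_operator_norm_le[OF y] by (simp add: l1_operator_apply[OF y])
  ultimately show "(\<lambda>k. l1_operator \<phi> y (x k)) \<longlonglongrightarrow> 0"
    by (rule Lim_null_comparison[OF always_eventually[OF allI], rotated])
qed

lemma l1_operator_nonneg:
  fixes y :: "nat \<Rightarrow> 'b::banach_lattice"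
  assumes "\<And>n. norm (y n) \<le> 1" "\<And>n. 0 \<le> y n"
  shows "0 \<le> l1_operator \<phi> y"
  unfolding less_eq_blinfun_def
proof (intro allI impI)
  fix x :: 'a assume "0 \<le> x"
  then show "blinfun_apply 0 x \<le> l1_operator \<phi> y x"
    using assms blinfun_nonneg[OF pos]
    by (simp add: l1_operator_apply banach_lattice_suminf_nonneg l1_operator_summable scaleR_nonneg_nonneg)
qed

text \<open>
  The adjoint maps \<open>g\<close> to \<open>\<Sum>n. g (y n) \<phi> n\<close>, a sum of positive terms. Hence it is at least
  each single term; this is what makes its norm large.
\<close>

lemma adjoint_l1_operator_ge:
  fixes y :: "nat \<Rightarrow> 'b::banach_lattice" and g :: "'b \<Rightarrow>\<^sub>L real"
  assumes y: "\<And>n. norm (y n) \<le> 1" "\<And>n. 0 \<le> y n" and g: "0 \<le> g"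
  shows "g (y n) *\<^sub>R \<phi> n \<le> adjoint_op (l1_operator \<phi> y) g"
  unfolding less_eq_blinfun_def
proof (intro allI impI)
  fix x :: 'a assume x: "0 \<le> x"
  have "\<phi> n x *\<^sub>R y n \<le> l1_operator \<phi> y x"
    unfolding l1_operator_apply[OF y(1)]
    by (rule banach_lattice_le_suminf[OF l1_operator_summable[OF y(1)]])
      (intro scaleR_nonneg_nonneg blinfun_nonneg pos x y(2))
  then have "g (\<phi> n x *\<^sub>R y n) \<le> g (l1_operator \<phi> y x)" by (rule blinfun_mono[OF g])
  then show "(g (y n) *\<^sub>R \<phi> n) x \<le> adjoint_op (l1_operator \<phi> y) g x"
    by (simp add: blinfun.scaleR_right blinfun.scaleR_left mult.commute)
qed

end

text \<open>
  The heart of the theorem: when the norm of the dual of \<open>'e\<close> is not order continuous, a positive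
  Dunford-Pettis operator can be fitted to any given positive sequence \<open>g\<close> in the dual of \<open>'f\<close>
  so that its adjoint shrinks the norms of the \<open>g n\<close> by at most a constant factor. The vectors \<open>y n\<close> are
  chosen in the positive unit ball with \<open>g n (y n)\<close> at least half of \<open>norm (g n)\<close>.
\<close>

lemma exists_dunford_pettis_detecting_norm_null:
  fixes g :: "nat \<Rightarrow> 'f::banach_lattice \<Rightarrow>\<^sub>L real"
  assumes E: "\<not> order_continuous_norm TYPE('e::banach_lattice \<Rightarrow>\<^sub>L real)"
    and g: "\<And>n. 0 \<le> g n"
  obtains T :: "'e::banach_lattice \<Rightarrow>\<^sub>L 'f" where "0 \<le> T" "dunford_pettis T"
    "(\<lambda>n. adjoint_op T (g n)) \<longlonglongrightarrow> 0 \<longrightarrow> g \<longlonglongrightarrow> 0"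
proof -
  obtain \<phi> :: "nat \<Rightarrow> 'e \<Rightarrow>\<^sub>L real" and \<psi> \<delta>
    where \<phi>: "\<And>n. 0 \<le> \<phi> n" "\<And>N. (\<Sum>n<N. \<phi> n) \<le> \<psi>" and \<delta>: "\<delta> > 0" "\<And>n. \<delta> \<le> norm (\<phi> n)"
    using not_order_continuous_norm_order_summable[OF E] by metis
  have "\<exists>y\<ge>0. norm y \<le> 1 \<and> norm (g n) / 2 \<le> g n y" for n
  proof (cases "g n = 0")
    case False
    then have "0 \<le> norm (g n) / 2" "norm (g n) / 2 < norm (g n)" by auto
    then obtain y where "0 \<le> y" "norm y \<le> 1" "norm (g n) / 2 < g n y"
      by (rule positive_functional_nearly_attains_norm[OF g])
    then show ?thesis by (intro exI[of _ y]) simp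
  next
    case True
    then show ?thesis by (intro exI[of _ 0]) simp
  qed
  then obtain y where y: "\<And>n. 0 \<le> y n" "\<And>n. norm (y n) \<le> 1" "\<And>n. norm (g n) / 2 \<le> g n (y n)"
    by metis
  let ?T = "l1_operator \<phi> y"
  have est: "norm (g n) \<le> 2 / \<delta> * norm (adjoint_op ?T (g n))" for n
  proof -
    have nn: "0 \<le> g n (y n)" by (rule blinfun_nonneg[OF g y(1)])
    have "norm (g n) / 2 * \<delta> \<le> g n (y n) * norm (\<phi> n)"
      using y(3) \<delta> nn by (intro mult_mono) auto
    also have "\<dots> = norm (g n (y n) *\<^sub>R \<phi> n)" using nn by simp
    also have "\<dots> \<le> norm (adjoint_op ?T (g n))"
    proof (rule lattice_norm)
      have "0 \<le> g n (y n) *\<^sub>R \<phi> n" by (rule scaleR_nonneg_nonneg[OF nn \<phi>(1)])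
      moreover have "g n (y n) *\<^sub>R \<phi> n \<le> adjoint_op ?T (g n)"
        by (rule adjoint_l1_operator_ge[OF \<phi> y(2,1) g])
      ultimately show "\<bar>g n (y n) *\<^sub>R \<phi> n\<bar> \<le> \<bar>adjoint_op ?T (g n)\<bar>"
        by (metis abs_of_nonneg order_trans)
    qed
    finally show ?thesis using \<delta>(1) by (simp add: field_simps)
  qed
  show ?thesis
  proof
    show "0 \<le> ?T" by (rule l1_operator_nonneg[OF \<phi> y(2,1)])
    show "dunford_pettis ?T" by (rule dunford_pettis_l1_operator[OF \<phi> y(2)])
    show "(\<lambda>n. adjoint_op ?T (g n)) \<longlonglongrightarrow> 0 \<longrightarrow> g \<longlonglongrightarrow> 0"
    proof
      assume "(\<lambda>n. adjoint_op ?T (g n)) \<longlonglongrightarrow> 0"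
      then have "(\<lambda>n. 2 / \<delta> * norm (adjoint_op ?T (g n))) \<longlonglongrightarrow> 0"
        by (intro tendsto_mult_right_zero tendsto_norm_zero)
      then show "g \<longlonglongrightarrow> 0"
        by (rule Lim_null_comparison[OF always_eventually[OF allI[OF est]]])
    qed
  qed
qed

section \<open>Weak* cluster points\<close>

text \<open>
  A sequential form of the Banach-Alaoglu theorem. By Tychonoff's theorem the functions bounded
  by the norm form a compact set for pointwise convergence, so the sequence has a pointwise
  cluster point \<open>h\<close> there; \<open>h\<close> is linear because finitely many values of \<open>h\<close> are approximated
  simultaneously by one \<open>G n\<close>. In general no subsequence converges.
\<close>

lemma weak_star_cluster_point:
  fixes G :: "nat \<Rightarrow> 'a::real_normed_vector \<Rightarrow>\<^sub>L real"
  assumes G: "\<And>n. norm (G n) \<le> 1"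
  obtains g :: "'a \<Rightarrow>\<^sub>L real" where
    "\<forall>A. finite A \<longrightarrow> (\<forall>\<epsilon>>0. \<exists>\<^sub>F n in sequentially. \<forall>x\<in>A. \<bar>G n x - g x\<bar> < \<epsilon>)"
proof -
  let ?K = "PiE UNIV (\<lambda>x::'a. cball (0::real) (norm x))"
  have "compactin (product_topology (\<lambda>_::'a. euclidean) UNIV) ?K"
    unfolding compactin_PiE by (simp add: compactin_euclidean_iff)
  then have "compact ?K" by (simp add: euclidean_product_topology compactin_euclidean_iff)
  moreover have "\<bar>G n x\<bar> \<le> norm x" for n x
    using norm_blinfun[of "G n" x] mult_right_mono[OF G[of n] norm_ge_zero[of x]] by simp
  then have "eventually (\<lambda>k. k \<in> ?K) (filtermap (\<lambda>n. blinfun_apply (G n)) sequentially)"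
    by (simp add: eventually_filtermap PiE_def Pi_def)
  ultimately obtain h where h: "h \<in> ?K"
      and cl: "inf (nhds h) (filtermap (\<lambda>n. blinfun_apply (G n)) sequentially) \<noteq> bot"
    unfolding compact_filter by (metis filtermap_bot_iff sequentially_bot)
  have freq: "\<exists>\<^sub>F n in sequentially. \<forall>x\<in>A. \<bar>G n x - h x\<bar> < \<epsilon>" if A: "finite A" "\<epsilon> > 0" for A and \<epsilon> :: real
  proof (rule ccontr)
    let ?U = "\<Inter>x\<in>A. {k. \<bar>k x - h x\<bar> < \<epsilon>}"
    assume "\<not> ?thesis"
    then have "eventually (\<lambda>n. blinfun_apply (G n) \<notin> ?U) sequentially"
      by (simp add: not_frequently)
    then have "eventually (\<lambda>k. k \<notin> ?U) (filtermap (\<lambda>n. blinfun_apply (G n)) sequentially)"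
      by (simp add: eventually_filtermap)
    moreover have "open ?U"
      using A(1) by (intro open_INT ballI open_Collect_less continuous_intros) auto
    then have "eventually (\<lambda>k. k \<in> ?U) (nhds h)"
      using A(2) by (intro eventually_nhds_in_open) auto
    ultimately have "eventually (\<lambda>k. False) (inf (nhds h) (filtermap (\<lambda>n. blinfun_apply (G n)) sequentially))"
      unfolding eventually_inf by blast
    then show False using cl by (simp add: trivial_limit_def)
  qed
  have "bounded_linear h"
  proof (rule bounded_linear_intro)
    fix x y :: 'a and r :: real
    have "\<bar>h (x + y) - (h x + h y)\<bar> \<le> 0 + e" if e: "e > 0" for e
    proof -
      obtain n where "\<forall>z\<in>{x, y, x + y}. \<bar>G n z - h z\<bar> < e / 3"
        using freq[of "{x, y, x + y}" "e / 3"] e by (auto dest: frequently_ex)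
      then have "\<bar>G n x - h x\<bar> < e / 3" "\<bar>G n y - h y\<bar> < e / 3" "\<bar>G n x + G n y - h (x + y)\<bar> < e / 3"
        by (auto simp: blinfun.add_right)
      then show ?thesis by linarith
    qed
    then show "h (x + y) = h x + h y" using field_le_epsilon[of "\<bar>h (x + y) - (h x + h y)\<bar>" 0] by simp
    have "\<bar>h (r *\<^sub>R x) - r * h x\<bar> \<le> 0 + e" if e: "e > 0" for e
    proof -
      define e' where "e' = e / (1 + \<bar>r\<bar>)"
      have e': "e' > 0" using e by (simp add: e'_def add_pos_nonneg)
      obtain n where "\<forall>z\<in>{x, r *\<^sub>R x}. \<bar>G n z - h z\<bar> < e'"
        using freq[of "{x, r *\<^sub>R x}" e'] e' by (auto dest: frequently_ex)
      then have "\<bar>G n x - h x\<bar> \<le> e'" and 2: "\<bar>r * G n x - h (r *\<^sub>R x)\<bar> < e'"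
        by (auto simp: blinfun.scaleR_right)
      then have "\<bar>r\<bar> * \<bar>G n x - h x\<bar> \<le> \<bar>r\<bar> * e'" by (intro mult_left_mono) auto
      then have "\<bar>r * G n x - r * h x\<bar> \<le> \<bar>r\<bar> * e'" by (simp add: abs_mult right_diff_distrib[symmetric])
      then have "\<bar>h (r *\<^sub>R x) - r * h x\<bar> \<le> e' * (1 + \<bar>r\<bar>)" using 2 by (simp add: algebra_simps)
      then show ?thesis by (simp add: e'_def split: if_splits)
    qed
    then show "h (r *\<^sub>R x) = r *\<^sub>R h x" using field_le_epsilon[of "\<bar>h (r *\<^sub>R x) - r * h x\<bar>" 0] by simp
    show "norm (h x) \<le> norm x * 1" using h by (auto simp: PiE_def Pi_def)
  qed
  then show ?thesis using that[of "Blinfun h"] freq by (simp add: bounded_linear_Blinfun_apply)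
qed

section \<open>Disjoint sequences from weakly null sequences\<close>

lemma pprt_scaleR_le: "0 \<le> c \<Longrightarrow> c \<le> 1 \<Longrightarrow> pprt (c *\<^sub>R a) \<le> pprt (a :: 'a::banach_lattice)"
proof -
  assume c: "0 \<le> c" "c \<le> 1"
  have "a \<le> pprt a" by (simp add: pprt_def)
  then have "c *\<^sub>R a \<le> c *\<^sub>R pprt a" using c by (intro scaleR_left_mono)
  also have "\<dots> \<le> pprt a" using scaleR_right_mono[OF c(2), of "pprt a"] by simp
  finally show ?thesis by (simp add: pprt_def[of "c *\<^sub>R a"])
qed

text \<open>
  For \<open>n < m\<close>, the truncation of \<open>x m\<close> lies below the positive part of \<open>a = x m - M m x n\<close>, since
  the sum contains \<open>x n\<close>. As \<open>x m / M m \<le> \<rho>\<close>, the truncation of \<open>x n\<close> lies below the positive part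
  of \<open>x n - x m / M m = - a / M m\<close>, hence below \<open>a\<^sup>-\<close>. Positive and negative parts are disjoint.
\<close>

lemma disjoint_truncations:
  fixes x :: "nat \<Rightarrow> 'a::banach_lattice"
  assumes x: "\<And>n. 0 \<le> x n" and \<rho>: "0 \<le> \<rho>" and M: "\<And>n. 1 \<le> M n" and dom: "\<And>n. x n \<le> M n *\<^sub>R \<rho>"
  shows "disjoint_seq (\<lambda>k. pprt (x k - M k *\<^sub>R (\<Sum>i<k. x i) - \<rho>))"
proof -
  define d where "d k = pprt (x k - M k *\<^sub>R (\<Sum>i<k. x i) - \<rho>)" for k
  have *: "inf (d m) (d n) = 0" if "n < m" for m n
  proof -
    define a where "a = x m - M m *\<^sub>R x n"
    have M0: "0 \<le> M k" for k using M[of k] by simp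
    have "x n \<le> (\<Sum>i<m. x i)"
      using sum_mono2[of "{..<m}" "{n}" x] that x by simp
    then have "M m *\<^sub>R x n \<le> M m *\<^sub>R (\<Sum>i<m. x i) + \<rho>"
      using M0 \<rho> by (metis add_increasing2 scaleR_left_mono)
    then have "d m \<le> pprt a" unfolding d_def a_def
      by (intro pprt_mono) (simp add: algebra_simps)
    have "0 \<le> M n *\<^sub>R (\<Sum>i<n. x i)" using M0 x by (intro scaleR_nonneg_nonneg sum_nonneg)
    moreover have "inverse (M m) *\<^sub>R x m \<le> inverse (M m) *\<^sub>R (M m *\<^sub>R \<rho>)"
      using dom M0 by (intro scaleR_left_mono) auto
    then have "inverse (M m) *\<^sub>R x m \<le> \<rho>" using M[of m] by simp
    ultimately have "x n - M n *\<^sub>R (\<Sum>i<n. x i) - \<rho> \<le> x n - inverse (M m) *\<^sub>R x m"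
      by (intro diff_mono) auto
    also have "\<dots> = inverse (M m) *\<^sub>R (- a)" using M[of m] by (simp add: a_def scaleR_diff_right)
    finally have "d n \<le> pprt (inverse (M m) *\<^sub>R (- a))" unfolding d_def by (rule pprt_mono)
    also have "\<dots> \<le> pprt (- a)" using M[of m] by (intro pprt_scaleR_le) (auto simp: field_simps)
    finally have "d n \<le> - nprt a" by (simp add: pprt_neg)
    with \<open>d m \<le> pprt a\<close> have "inf (d m) (d n) \<le> 0"
      using inf_mono inf_pprt_nprt[of a] by metis
    then show ?thesis by (intro order.antisym) (auto simp: d_def)
  qed
  have "disjoint_seq d"
    unfolding disjoint_seq_def
  proof (intro allI impI)
    fix m n :: nat assume "m \<noteq> n"
    then show "inf \<bar>d m\<bar> \<bar>d n\<bar> = 0"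
      using *[of m n] *[of n m] by (cases "m < n") (auto simp: d_def inf_commute)
  qed
  then show ?thesis by (simp add: d_def[abs_def])
qed

lemma weakly_null_truncations:
  fixes x :: "nat \<Rightarrow> 'a::banach_lattice"
  assumes wn: "weakly_null x" and x: "\<And>n. 0 \<le> x n" and \<rho>: "0 \<le> \<rho>" and M: "\<And>n. 1 \<le> M n"
  shows "weakly_null (\<lambda>k. pprt (x k - M k *\<^sub>R (\<Sum>i<k. x i) - \<rho>))"
proof (rule weakly_null_dominated[OF wn])
  fix n
  have "0 \<le> M n *\<^sub>R (\<Sum>i<n. x i)" using M[of n] x by (intro scaleR_nonneg_nonneg sum_nonneg) auto
  then have "x n - M n *\<^sub>R (\<Sum>i<n. x i) - \<rho> \<le> x n"
    using \<rho> by (metis add.right_neutral add_mono diff_diff_eq diff_le_eq add_increasing2 order_refl add_nonneg_nonneg)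
  then show "pprt (x n - M n *\<^sub>R (\<Sum>i<n. x i) - \<rho>) \<le> x n"
    using x by (simp add: pprt_def)
qed simp

text \<open>
  A subsequence is chosen term by term, where the choice of a term depends only on the sum of the
  terms chosen before; \<open>Q\<close> is an invariant of these sums which keeps the choice going.
\<close>

lemma greedy_subsequence:
  fixes x :: "nat \<Rightarrow> 'a::comm_monoid_add"
  assumes Q: "Q 0" and step: "\<And>k v N. Q v \<Longrightarrow> \<exists>n>N. R k v n \<and> Q (v + x n)"
  obtains r :: "nat \<Rightarrow> nat" where "strict_mono r" "\<And>k. r k > K" "\<And>k. R k (\<Sum>i<k. x (r i)) (r k)"
proof -
  define S where "S k p q \<longleftrightarrow> snd p < snd q \<and> R k (fst p) (snd q) \<and> fst q = fst p + x (snd q)"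
    for k and p q :: "'a \<times> nat"
  have "\<exists>q. Q (fst q) \<and> S k p q" if Qp: "Q (fst p)" for k p
  proof -
    obtain n where "n > snd p" "R k (fst p) n" "Q (fst p + x n)" using step[OF Qp] by blast
    then show ?thesis by (intro exI[of _ "(fst p + x n, n)"]) (simp add: S_def)
  qed
  then obtain p where p0: "p 0 = (0, K)" and p: "\<And>k. S k (p k) (p (Suc k))"
    using dependent_nat_choice[of "\<lambda>k q. Q (fst q) \<and> (k = 0 \<longrightarrow> q = (0, K))" S] Q
    by (metis fst_conv nat.distinct(1))
  define r where "r k = snd (p (Suc k))" for k
  have sums: "fst (p k) = (\<Sum>i<k. x (r i))" for k
    by (induction k) (use p0 p in \<open>auto simp: S_def r_def\<close>)
  have mono: "strict_mono (\<lambda>k. snd (p k))" using p by (simp add: strict_mono_Suc_iff S_def)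
  then have "strict_mono r" by (simp add: r_def strict_mono_Suc_iff)
  moreover have "r k > K" for k using strict_mono_less[OF mono, of 0 "Suc k"] p0 by (simp add: r_def)
  moreover have "R k (\<Sum>i<k. x (r i)) (r k)" for k using p[of k] sums[of k] by (simp add: S_def r_def)
  ultimately show ?thesis using that by blast
qed

text \<open>
  Suppose that the sequence is not almost order bounded, so that after subtracting any \<open>u\<close> some
  later term still has a large positive part. Then terms can be chosen which stay large after
  subtracting a rapidly growing multiple \<open>M k\<close> of the sum of their predecessors. As \<open>M\<close> grows like
  \<open>2 ^ k\<close>, a multiple of \<open>\<Sum>k. z k / 2 ^ k\<close> serves as \<open>\<rho>\<close>; the factor \<open>1 + 4 / \<delta>\<close> in \<open>M\<close> makes
  \<open>\<rho>\<close> small enough for subtracting it to be harmless.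
\<close>

lemma disjoint_weakly_null_of_unbounded:
  fixes x :: "nat \<Rightarrow> 'a::banach_lattice"
  assumes wn: "weakly_null x" and x: "\<And>n. 0 \<le> x n" and norm1: "\<And>n. norm (x n) \<le> 1" and \<delta>: "\<delta> > 0"
    and escape: "\<And>u N. 0 \<le> u \<Longrightarrow> \<exists>n>N. \<delta> \<le> norm (pprt (x n - u))"
  obtains d :: "nat \<Rightarrow> 'a" where "disjoint_seq d" "\<And>n. 0 \<le> d n" "weakly_null d" "\<not> d \<longlonglongrightarrow> 0"
proof -
  define M where "M k = 2 ^ k * (1 + 4 / \<delta>)" for k :: nat
  have M: "1 \<le> M k" for k
  proof -
    have "1 * 1 \<le> M k" unfolding M_def using \<delta> by (intro mult_mono) auto
    then show ?thesis by simp
  qed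
  obtain r where r: "strict_mono r"
    and big: "\<And>k. \<delta> \<le> norm (pprt (x (r k) - M k *\<^sub>R (\<Sum>i<k. x (r i))))"
  proof (rule greedy_subsequence[where Q = "\<lambda>v. 0 \<le> v" and x = x and K = 0
        and R = "\<lambda>k v n. \<delta> \<le> norm (pprt (x n - M k *\<^sub>R v))"])
    fix k :: nat and v :: 'a and N :: nat assume v: "0 \<le> v"
    then have "0 \<le> M k *\<^sub>R v" using M[of k] by (intro scaleR_nonneg_nonneg) auto
    then show "\<exists>n>N. \<delta> \<le> norm (pprt (x n - M k *\<^sub>R v)) \<and> 0 \<le> v + x n"
      using escape[of "M k *\<^sub>R v" N] v x by (auto intro: add_nonneg_nonneg)
  qed auto
  define z where "z k = x (r k)" for k
  have z: "\<And>k. 0 \<le> z k" "\<And>k. norm (z k) \<le> 1" using x norm1 by (auto simp: z_def)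
  define t where "t k = (1 / 2) ^ k *\<^sub>R z k" for k
  have tn: "norm (t k) \<le> (1 / 2) ^ k" for k using z(2)[of k] by (simp add: t_def mult_left_le)
  have st: "summable t" by (rule summable_comparison_test[OF _ summable_geometric[of "1/2"]]) (use tn in auto)
  have t0: "0 \<le> t k" for k using z(1) by (simp add: t_def scaleR_nonneg_nonneg)
  have "norm (suminf t) \<le> (\<Sum>k. (1 / 2) ^ k)" by (rule norm_suminf_le[OF tn summable_geometric]) simp
  then have w2: "norm (suminf t) \<le> 2" by (simp add: suminf_geometric)
  define c where "c = 1 + 4 / \<delta>"
  have c: "c > 0" "2 / c \<le> \<delta> / 2" using \<delta> by (auto simp: c_def field_simps add_pos_pos)
  define \<rho> where "\<rho> = inverse c *\<^sub>R suminf t"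
  have \<rho>: "0 \<le> \<rho>" unfolding \<rho>_def using c(1) by (intro scaleR_nonneg_nonneg banach_lattice_suminf_nonneg st t0) auto
  have "norm \<rho> = norm (suminf t) / c" using c(1) by (simp add: \<rho>_def divide_inverse mult.commute)
  also have "\<dots> \<le> 2 / c" using w2 c(1) by (intro divide_right_mono) auto
  finally have \<rho>_small: "norm \<rho> \<le> \<delta> / 2" using c(2) by simp
  have dom: "z k \<le> M k *\<^sub>R \<rho>" for k
  proof -
    have "z k = 2 ^ k *\<^sub>R t k" by (simp add: t_def power_one_over)
    also have "\<dots> \<le> 2 ^ k *\<^sub>R suminf t"
      by (intro scaleR_left_mono banach_lattice_le_suminf st t0) auto
    also have "\<dots> = M k *\<^sub>R \<rho>" using c(1) by (simp add: \<rho>_def M_def c_def[symmetric])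
    finally show ?thesis .
  qed
  define d where "d k = pprt (z k - M k *\<^sub>R (\<Sum>i<k. z i) - \<rho>)" for k
  have "\<delta> / 2 \<le> norm (d k)" for k
  proof -
    define a where "a = z k - M k *\<^sub>R (\<Sum>i<k. z i)"
    have "a \<le> pprt (a - \<rho>) + \<rho>" by (metis diff_le_eq pprt_def sup_ge1)
    moreover have "0 \<le> pprt (a - \<rho>) + \<rho>" using \<rho> by simp
    ultimately have "pprt a \<le> pprt (a - \<rho>) + \<rho>" by (simp add: pprt_def[of a])
    then have "norm (pprt a) \<le> norm (pprt (a - \<rho>) + \<rho>)"
      using \<rho> by (intro lattice_norm) simp
    also have "\<dots> \<le> norm (pprt (a - \<rho>)) + norm \<rho>" by (rule norm_triangle_ineq)
    finally show ?thesis using big[of k] \<rho>_small by (simp add: d_def a_def z_def)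
  qed
  then have "\<not> d \<longlonglongrightarrow> 0"
    using \<delta> LIMSEQ_le_const[OF tendsto_norm[of d 0], of "\<delta> / 2"] by auto
  moreover have "disjoint_seq d"
    unfolding d_def by (rule disjoint_truncations[OF z(1) \<rho> M dom])
  moreover have "weakly_null d"
    unfolding d_def using weakly_null_subseq[OF wn r] z(1) \<rho> M
    by (intro weakly_null_truncations) (auto simp: z_def)
  ultimately show ?thesis using that[of d] by (simp add: d_def)
qed

text \<open>
  When all \<open>z n\<close> lie below a fixed \<open>u\<close>, a constant multiplier \<open>M\<close> with \<open>\<rho> = u / M\<close> suffices. The
  obstacle is to find terms that stay large after subtracting \<open>M\<close> times the sum \<open>v\<close> of their
  predecessors, and it is enough that \<open>v (y n)\<close> is small for the witness \<open>y n\<close> of the size of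
  \<open>z n\<close>. Let \<open>g\<close> be a weak* cluster point of the \<open>y n\<close> in the bidual. For infinitely many \<open>n\<close> the
  number \<open>v (y n)\<close> is close to \<open>g v\<close>, and \<open>g (z n)\<close> tends to \<open>0\<close> because \<open>z\<close> is weakly null; so \<open>g v\<close>
  can be kept below any bound given in advance while the terms of \<open>v\<close> accumulate.
\<close>

lemma disjoint_weakly_null_of_order_bounded:
  fixes z :: "nat \<Rightarrow> 'a::banach_lattice \<Rightarrow>\<^sub>L real"
  assumes wn: "weakly_null z" and z: "\<And>n. 0 \<le> z n" "\<And>n. z n \<le> u" and \<delta>: "\<delta> > 0"
    and y: "\<And>n. 0 \<le> y n" "\<And>n. norm (y n) \<le> 1" "\<And>n. n > K \<Longrightarrow> \<delta> \<le> z n (y n)"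
  obtains d :: "nat \<Rightarrow> 'a \<Rightarrow>\<^sub>L real" where
    "disjoint_seq d" "\<And>n. 0 \<le> d n" "weakly_null d" "\<not> d \<longlonglongrightarrow> 0"
proof -
  \<comment> \<open>The canonical embedding into the bidual.\<close>
  define J :: "'a \<Rightarrow> ('a \<Rightarrow>\<^sub>L real) \<Rightarrow>\<^sub>L real" where "J y = Blinfun (\<lambda>f. blinfun_apply f y)" for y
  have J: "J y f = f y" for y and f :: "'a \<Rightarrow>\<^sub>L real"
    unfolding J_def by (simp add: bounded_linear_Blinfun_apply blinfun.bounded_linear_left)
  have norm_J: "norm (J (y n)) \<le> 1" for n
  proof (rule norm_blinfun_bound)
    fix f :: "'a \<Rightarrow>\<^sub>L real"
    show "norm (J (y n) f) \<le> 1 * norm f"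
      using norm_blinfun[of f "y n"] mult_left_mono[OF y(2)[of n] norm_ge_zero[of f]] by (simp add: J)
  qed simp
  obtain g :: "('a \<Rightarrow>\<^sub>L real) \<Rightarrow>\<^sub>L real" where
    g: "\<forall>A. finite A \<longrightarrow> (\<forall>\<epsilon>>0. \<exists>\<^sub>F n in sequentially. \<forall>f\<in>A. \<bar>J (y n) f - g f\<bar> < \<epsilon>)"
    by (rule weak_star_cluster_point[of "\<lambda>n. J (y n)", OF norm_J])
  define M where "M = 1 + 4 * norm u / \<delta>"
  have "M * (\<delta> / 4) = \<delta> / 4 + norm u" using \<delta> by (simp add: M_def distrib_right)
  then have M: "1 \<le> M" "norm u \<le> M * (\<delta> / 4)" using \<delta> by (simp_all add: M_def)
  \<comment> \<open>With this bound on \<open>g v\<close>, subtracting \<open>M v\<close> costs at most \<open>2 M c = \<delta> / 2\<close> at the witness,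
      and subtracting \<open>\<rho>\<close> costs at most \<open>\<delta> / 4\<close>, which leaves \<open>\<delta> / 4\<close>.\<close>
  define c where "c = \<delta> / (4 * M)"
  have c: "c > 0" "M * c = \<delta> / 4" using M \<delta> by (auto simp: c_def)
  have u: "0 \<le> u" using z order_trans by blast
  obtain r :: "nat \<Rightarrow> nat" where r: "strict_mono r" "\<And>k. r k > K"
    and small: "\<And>k. (\<Sum>i<k. z (r i)) (y (r k)) < 2 * c"
  proof (rule greedy_subsequence[where Q = "\<lambda>v. g v < c" and x = z and K = K
        and R = "\<lambda>k v n. blinfun_apply v (y n) < 2 * c"])
    fix k N :: nat and v :: "'a \<Rightarrow>\<^sub>L real" assume v: "g v < c"
    have "(\<lambda>n. g (z n)) \<longlonglongrightarrow> 0" using wn by (simp add: weakly_null_def)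
    then have "eventually (\<lambda>n. g (z n) < c - g v) sequentially"
      using v by (intro order_tendstoD(2)[where y = 0]) auto
    then have ev: "eventually (\<lambda>n. g (z n) < c - g v \<and> n > N) sequentially"
      using eventually_gt_at_top[of N] by eventually_elim simp
    have "\<exists>\<^sub>F n in sequentially. \<forall>f\<in>{v}. \<bar>J (y n) f - g f\<bar> < c" using g c by blast
    then obtain n where "\<bar>J (y n) v - g v\<bar> < c" "g (z n) < c - g v" "n > N"
      using frequently_eventually_conj[OF _ ev] by (auto dest: frequently_ex)
    then show "\<exists>n>N. v (y n) < 2 * c \<and> g (v + z n) < c"
      using v by (intro exI[of _ n]) (auto simp: J blinfun.add_right)
  next
    show "g 0 < c" using c by (simp add: blinfun.zero_right)
  qed blast
  define x where "x k = z (r k)" for k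
  define \<rho> where "\<rho> = inverse M *\<^sub>R u"
  have \<rho>: "0 \<le> \<rho>" unfolding \<rho>_def using M u by (intro scaleR_nonneg_nonneg) auto
  define d where "d k = pprt (x k - M *\<^sub>R (\<Sum>i<k. x i) - \<rho>)" for k
  have "\<delta> / 4 \<le> norm (d k)" for k
  proof -
    let ?y = "y (r k)"
    have n1: "f ?y \<le> norm f" for f :: "'a \<Rightarrow>\<^sub>L real"
      using norm_blinfun[of f ?y] mult_left_mono[OF y(2)[of "r k"] norm_ge_zero[of f]] by simp
    have "norm \<rho> \<le> \<delta> / 4" using M by (simp add: \<rho>_def field_simps)
    then have "\<rho> ?y \<le> \<delta> / 4" using n1[of \<rho>] by linarith
    moreover have "M * (\<Sum>i<k. x i) ?y \<le> M * (2 * c)"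
      using small[of k] M by (intro mult_left_mono) (auto simp: x_def)
    moreover have "\<delta> \<le> x k ?y" using y(3) r(2) by (simp add: x_def)
    ultimately have "\<delta> / 4 \<le> (x k - M *\<^sub>R (\<Sum>i<k. x i) - \<rho>) ?y"
      using c(2) by (simp add: blinfun.diff_left blinfun.scaleR_left)
    also have "\<dots> \<le> d k ?y"
    proof -
      have "x k - M *\<^sub>R (\<Sum>i<k. x i) - \<rho> \<le> d k" by (simp add: d_def pprt_def)
      then show ?thesis using y(1) by (simp add: less_eq_blinfun_def)
    qed
    also have "\<dots> \<le> norm (d k)" by (rule n1)
    finally show ?thesis .
  qed
  then have "\<not> d \<longlonglongrightarrow> 0"
    using \<delta> LIMSEQ_le_const[OF tendsto_norm[of d 0], of "\<delta> / 4"] by auto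
  moreover have "disjoint_seq d"
    unfolding d_def using M z by (intro disjoint_truncations \<rho>) (auto simp: x_def \<rho>_def)
  moreover have "weakly_null d"
    unfolding d_def using weakly_null_subseq[OF wn r(1)] z(1) \<rho> M
    by (intro weakly_null_truncations) (auto simp: x_def)
  ultimately show ?thesis using that[of d] by (simp add: d_def)
qed

text \<open>
  In a dual Banach lattice the positive Schur property can be tested on disjoint sequences. After
  normalisation there are two cases. Either the sequence escapes every order interval and its own
  truncations work, or up to a part of norm less than \<open>1 / 4\<close> the sequence lies in one order
  interval \<open>[0, u]\<close>, and its meets with \<open>u\<close> form an order bounded weakly null sequence that is
  still not norm null.
\<close>

lemma not_positive_schur_dual_disjoint:
  assumes "\<not> positive_schur TYPE('a::banach_lattice \<Rightarrow>\<^sub>L real)"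
  obtains d :: "nat \<Rightarrow> 'a::banach_lattice \<Rightarrow>\<^sub>L real" where
    "disjoint_seq d" "\<And>n. 0 \<le> d n" "weakly_null d" "\<not> d \<longlonglongrightarrow> 0"
proof -
  obtain f :: "nat \<Rightarrow> 'a \<Rightarrow>\<^sub>L real" where f: "\<And>n. 0 \<le> f n" "weakly_null f" "\<not> f \<longlonglongrightarrow> 0"
    using assms unfolding positive_schur_def by blast
  obtain \<epsilon> where \<epsilon>: "\<epsilon> > 0" "\<And>N. \<exists>n\<ge>N. \<epsilon> \<le> norm (f n)"
    using f(3) unfolding lim_sequentially by (auto simp: not_less)
  have "\<exists>r::nat\<Rightarrow>nat. \<forall>n. \<epsilon> \<le> norm (f (r n)) \<and> r n < r (Suc n)"
    by (rule dependent_nat_choice) (use \<epsilon>(2) Suc_le_lessD in blast)+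
  then obtain r :: "nat \<Rightarrow> nat" where "\<forall>n. \<epsilon> \<le> norm (f (r n)) \<and> r n < r (Suc n)" ..
  then have r: "strict_mono r" "\<And>n. \<epsilon> \<le> norm (f (r n))" by (simp_all add: strict_mono_Suc_iff)
  \<comment> \<open>Along a subsequence bounded below in norm, normalising keeps the sequence weakly null:
      the factors are at most \<open>inverse \<epsilon>\<close>.\<close>
  define x where "x n = inverse (norm (f (r n))) *\<^sub>R f (r n)" for n
  have nz: "norm (f (r n)) > 0" for n using r(2)[of n] \<epsilon>(1) by linarith
  have x0: "0 \<le> x n" for n using f(1) by (simp add: x_def scaleR_nonneg_nonneg)
  have x1: "norm (x n) = 1" for n using nz[of n] by (simp add: x_def)
  have "x n \<le> inverse \<epsilon> *\<^sub>R f (r n)" for n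
    unfolding x_def using r(2)[of n] \<epsilon>(1) f(1) by (intro scaleR_right_mono le_imp_inverse_le) auto
  moreover have "weakly_null (\<lambda>n. inverse \<epsilon> *\<^sub>R f (r n))"
    using weakly_null_subseq[OF f(2) r(1)]
    by (auto simp: weakly_null_def blinfun.scaleR_right intro: tendsto_mult_right_zero)
  ultimately have wx: "weakly_null x" 
    using weakly_null_dominated[of "\<lambda>n. inverse \<epsilon> *\<^sub>R f (r n)" x] x0 by blast
  show ?thesis
  proof (cases "\<forall>u\<ge>0. \<forall>N. \<exists>n>N. 1 / 4 \<le> norm (pprt (x n - u))")
    case True
    then show ?thesis
      using disjoint_weakly_null_of_unbounded[OF wx x0, of "1 / 4"] x1 that by auto
  next
    case False
    then obtain u N where u: "0 \<le> u" and N: "\<And>n. n > N \<Longrightarrow> norm (pprt (x n - u)) < 1 / 4"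
      by (auto simp: not_le)
    \<comment> \<open>This is the meet of \<open>x n\<close> and \<open>u\<close>.\<close>
    define z where "z n = x n - pprt (x n - u)" for n
    have zx: "z n \<le> x n" for n by (simp add: z_def)
    have z0: "0 \<le> z n" for n
    proof -
      have "pprt (x n - u) \<le> x n"
        unfolding pprt_def using x0 u by (intro sup_least) (simp_all add: diff_le_eq)
      then show ?thesis by (simp add: z_def)
    qed
    have zu: "z n \<le> u" for n
      unfolding z_def pprt_def by (metis diff_le_eq add.commute sup_ge1)
    have "\<exists>y\<ge>0. norm y \<le> 1 \<and> 1 / 2 < x n y" for n
    proof -
      have "(0::real) \<le> 1 / 2" "1 / 2 < norm (x n)" by (simp_all add: x1)
      then obtain y where "0 \<le> y" "norm y \<le> 1" "1 / 2 < x n y"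
        by (rule positive_functional_nearly_attains_norm[OF x0])
      then show ?thesis by blast
    qed
    then obtain y where y: "\<And>n. 0 \<le> y n" "\<And>n. norm (y n) \<le> 1" "\<And>n. 1 / 2 < x n (y n)" by metis
    have "1 / 4 \<le> z n (y n)" if "n > N" for n
    proof -
      have "pprt (x n - u) (y n) \<le> norm (pprt (x n - u)) * norm (y n)"
        using norm_blinfun[of "pprt (x n - u)" "y n"] by simp
      also have "\<dots> \<le> norm (pprt (x n - u))" using y(2) by (simp add: mult_left_le)
      also have "\<dots> < 1 / 4" using N that by blast
      finally show ?thesis using y(3)[of n] by (simp add: z_def blinfun.diff_left)
    qed
    then show ?thesis
      using disjoint_weakly_null_of_order_bounded[OF weakly_null_dominated[OF wx z0 zx] z0 zu, of "1/4" y N]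
        y(1,2) that by auto
  qed
qed

section \<open>Adjoints of positive Dunford-Pettis operators\<close>

theorem theorem3p5:
  shows "((\<forall>T :: 'e::banach_lattice \<Rightarrow>\<^sub>L 'f::banach_lattice.
             0 \<le> T \<and> dunford_pettis T \<longrightarrow> almost_dunford_pettis (adjoint_op T)) \<longrightarrow>
           order_continuous_norm TYPE('e \<Rightarrow>\<^sub>L real) \<or> positive_schur TYPE('f \<Rightarrow>\<^sub>L real)) \<and>
         ((\<forall>T :: 'e \<Rightarrow>\<^sub>L 'f. 0 \<le> T \<and> dunford_pettis T \<longrightarrow> positively_limited T) \<longrightarrow>
           order_continuous_norm TYPE('e \<Rightarrow>\<^sub>L real) \<or> dual_positive_schur TYPE('f))"
proof (intro conjI impI)
  assume hyp: "\<forall>T :: 'e \<Rightarrow>\<^sub>L 'f. 0 \<le> T \<and> dunford_pettis T \<longrightarrow> almost_dunford_pettis (adjoint_op T)"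
  show "order_continuous_norm TYPE('e \<Rightarrow>\<^sub>L real) \<or> positive_schur TYPE('f \<Rightarrow>\<^sub>L real)"
  proof (rule ccontr)
    assume "\<not> ?thesis"
    then have E: "\<not> order_continuous_norm TYPE('e \<Rightarrow>\<^sub>L real)"
      and F: "\<not> positive_schur TYPE('f \<Rightarrow>\<^sub>L real)" by auto
    obtain d :: "nat \<Rightarrow> 'f \<Rightarrow>\<^sub>L real" where d: "disjoint_seq d" "\<And>n. 0 \<le> d n" "weakly_null d" "\<not> d \<longlonglongrightarrow> 0"
      using not_positive_schur_dual_disjoint[OF F] by blast
    obtain T :: "'e \<Rightarrow>\<^sub>L 'f" where T: "0 \<le> T" "dunford_pettis T"
        "(\<lambda>n. adjoint_op T (d n)) \<longlonglongrightarrow> 0 \<longrightarrow> d \<longlonglongrightarrow> 0"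
      by (rule exists_dunford_pettis_detecting_norm_null[where g = d, OF E d(2)])
    show False using hyp T d unfolding almost_dunford_pettis_def by blast
  qed
next
  assume hyp: "\<forall>T :: 'e \<Rightarrow>\<^sub>L 'f. 0 \<le> T \<and> dunford_pettis T \<longrightarrow> positively_limited T"
  have "dual_positive_schur TYPE('f)" if E: "\<not> order_continuous_norm TYPE('e \<Rightarrow>\<^sub>L real)"
    unfolding dual_positive_schur_def
  proof (intro allI impI, elim conjE)
    fix g :: "nat \<Rightarrow> 'f \<Rightarrow>\<^sub>L real" assume g: "\<forall>n. 0 \<le> g n" "weak_star_null g"
    obtain T :: "'e \<Rightarrow>\<^sub>L 'f" where T: "0 \<le> T" "dunford_pettis T"
        "(\<lambda>n. adjoint_op T (g n)) \<longlonglongrightarrow> 0 \<longrightarrow> g \<longlonglongrightarrow> 0"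
      by (rule exists_dunford_pettis_detecting_norm_null[where g = g, OF E g(1)[rule_format]])
    show "g \<longlonglongrightarrow> 0" using hyp T g unfolding positively_limited_def by blast
  qed
  then show "order_continuous_norm TYPE('e \<Rightarrow>\<^sub>L real) \<or> dual_positive_schur TYPE('f)" by blast
qed

end
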